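(* There exist an outer function $g$ in $H^2$ such that $|g|^2$ is a Muckenhoupt $(A_2)$ weight on $\mathbb{T}$, and an inner function $I$, such that $K^2_I(|g|^2)\not\subset K^2_I$.
   Context: $\mathbb{D}$ is the open unit disk, $\mathbb{T}$ the unit circle, $H^2$ the Hardy space of $\mathbb{D}$. For an outer function $g\in H^2$, $H^2(|g|^2)=\{f \text{ holomorphic in }\mathbb{D}: fg\in H^2\}$ and $H^2_0(|g|^2)=\{\psi\in H^2(|g|^2):\psi(0)=0\}$. For an inner function $I$, $K^2_I(|g|^2)$ is the set of $f\in H^2(|g|^2)$ for which there is $\psi\in H^2_0(|g|^2)$ with $f=I\overline{\psi}$ a.e. on $\mathbb{T}$ (boundary values); $K^2_I=H^2\cap I\,\overline{H^2_0}$ is the unweighted case $g\equiv1$. A weight $w$ on $\mathbb{T}$ is a Muckenhoupt $(A_2)$ weight if $\sup_{J}\bigl(\frac1{|J|}\int_J w\,dx\bigr)\bigl(\frac1{|J|}\int_J w^{-1}dx\bigr)<\infty$, the supremum being over all subarcs $J$ of $\mathbb{T}$. *)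

theory Defs
  imports "HOL-Analysis.Analysis"
begin

text \<open>
  Functions on the open unit disc are total functions on the complex numbers of which only the
  values on \<^term>\<open>ball (0::complex) 1\<close> matter. The unit circle is parametrised by \<^const>\<open>cis\<close>
  and carries arc length; \<^term>\<open>AE t in lebesgue. P (cis t)\<close> over the whole real line says
  ``almost everywhere on the circle'', by periodicity.
\<close>

definition hardy2 :: "(complex \<Rightarrow> complex) set" where
  "hardy2 = {f. f holomorphic_on ball 0 1 \<and>
     bdd_above ((\<lambda>r::real. (1 / (2 * pi)) *
        (LINT t:{0..2*pi}|lebesgue. (norm (f (of_real r * cis t)))\<^sup>2)) ` {0..<1})}"

text \<open>
  Boundary values are radial limits. \<^const>\<open>Lim\<close> is an unspecified value where there is no limit;
  by Fatou's theorem this concerns only a null set of the circle for functions of the Nevanlinna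
  class, hence for inner functions and for members of the (weighted) Hardy spaces below.
\<close>

definition boundary_value :: "(complex \<Rightarrow> complex) \<Rightarrow> complex \<Rightarrow> complex" where
  "boundary_value f z = Lim (at_left 1) (\<lambda>r::real. f (of_real r * z))"

definition inner_function :: "(complex \<Rightarrow> complex) \<Rightarrow> bool" where
  "inner_function I \<longleftrightarrow> I holomorphic_on ball 0 1 \<and> (\<forall>z\<in>ball 0 1. norm (I z) \<le> 1) \<and>
     (AE t in lebesgue. norm (boundary_value I (cis t)) = 1)"

text \<open>
  Outer functions have the form
  \[ g(z) = c \exp\Bigl(\frac{1}{2\pi} \int_0^{2\pi} \frac{e^{it}+z}{e^{it}-z} \log \varphi(t)\,dt\Bigr) \]
  with $|c| = 1$, $\varphi > 0$ and $\log\varphi$ integrable.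
\<close>

definition outer_function :: "(complex \<Rightarrow> complex) \<Rightarrow> bool" where
  "outer_function g \<longleftrightarrow> (\<exists>(c::complex) (\<phi>::real \<Rightarrow> real).
     norm c = 1 \<and> (\<forall>t. \<phi> t > 0) \<and>
     set_integrable lebesgue {0..2*pi} (\<lambda>t. ln (\<phi> t)) \<and>
     (\<forall>z\<in>ball 0 1. g z = c * exp ((1 / (2 * of_real pi)) *
        (LINT t:{0..2*pi}|lebesgue. (cis t + z) / (cis t - z) * of_real (ln (\<phi> t))))))"

definition weighted_hardy2 :: "(complex \<Rightarrow> complex) \<Rightarrow> (complex \<Rightarrow> complex) set" where
  "weighted_hardy2 g = {f. f holomorphic_on ball 0 1 \<and> (\<lambda>z. f z * g z) \<in> hardy2}"

definition weighted_hardy2_0 :: "(complex \<Rightarrow> complex) \<Rightarrow> (complex \<Rightarrow> complex) set" where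
  "weighted_hardy2_0 g = {\<psi> \<in> weighted_hardy2 g. \<psi> 0 = 0}"

definition weighted_model_space ::
    "(complex \<Rightarrow> complex) \<Rightarrow> (complex \<Rightarrow> complex) \<Rightarrow> (complex \<Rightarrow> complex) set" where
  "weighted_model_space g I = {f \<in> weighted_hardy2 g. \<exists>\<psi>\<in>weighted_hardy2_0 g.
     AE t in lebesgue. boundary_value f (cis t) =
       boundary_value I (cis t) * cnj (boundary_value \<psi> (cis t))}"

definition model_space :: "(complex \<Rightarrow> complex) \<Rightarrow> (complex \<Rightarrow> complex) set" where
  "model_space I = {f \<in> hardy2. \<exists>\<psi>\<in>hardy2. \<psi> 0 = 0 \<and>
     (AE t in lebesgue. boundary_value f (cis t) =
       boundary_value I (cis t) * cnj (boundary_value \<psi> (cis t)))}"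

lemma weighted_hardy2_one: "weighted_hardy2 (\<lambda>_. 1) = hardy2"
  by (auto simp: weighted_hardy2_def hardy2_def)

lemma weighted_model_space_one: "weighted_model_space (\<lambda>_. 1) I = model_space I"
  by (auto simp: weighted_model_space_def model_space_def weighted_hardy2_0_def
      weighted_hardy2_one)

text \<open>
  The arcs are the images under \<^const>\<open>cis\<close> of the intervals from $a$ to $b$ with
  $a < b \le a + 2\pi$. The integrals take values in \<^typ>\<open>ennreal\<close>, so that
  non-integrable weights are not admitted by the convention that their integral is 0; positivity
  almost everywhere excludes products $0 \cdot \infty$.
\<close>

definition muckenhoupt_A2 :: "(complex \<Rightarrow> real) \<Rightarrow> bool" where
  "muckenhoupt_A2 w \<longleftrightarrow>
     (\<lambda>t. w (cis t)) \<in> borel_measurable lebesgue \<and>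
     (AE t in lebesgue. w (cis t) > 0) \<and>
     (SUP (a, b) \<in> {(a::real, b). a < b \<and> b \<le> a + 2 * pi}.
        ((\<integral>\<^sup>+t\<in>{a..b}. ennreal (w (cis t)) \<partial>lebesgue) / ennreal (b - a)) *
        ((\<integral>\<^sup>+t\<in>{a..b}. ennreal (inverse (w (cis t))) \<partial>lebesgue) / ennreal (b - a))) < \<infinity>"

end

theory Submission
  imports Defs "HOL-Complex_Analysis.Complex_Analysis"
begin

text \<open>
  The example is $g(z) = (1-z)^{1/3}$ and the atomic inner function $I = e^{-u}$, where
  $u(z) = (1+z)/(1-z)$ maps the disc to the right half-plane and the circle to the imaginary axis.
  The weight $|g|^2 = |1-z|^{2/3}$ vanishes at 1, so the weighted space tolerates more growth there
  than $H^2$ does, and 1 is exactly where $I$ is singular. The function that exploits this is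
  $f = G(u)/(1+z)$ with the entire function
  $G(u) = \sum_n c_n (1 - e^{-t_n u})$, $c_n = 128^n$, $t_n = 4096^{-n}$.

  \<^item> Since $u$ is imaginary on the circle and the coefficients are real, the conjugate of $G(u)$
    is $G(-u)$ there. Hence $f = I \overline\psi$ for $\psi = z e^{-u} G(-u)/(1+z)$, which is
    holomorphic in the disc and vanishes at 0.

  \<^item> For $w$ in the closed right half-plane $|1-e^{-w}| \le 2|w|^{2/3}$. As
    $\sum_n c_n t_n^{2/3} = \sum_n 2^{-n} = 2$ and all $t_n \le 1$, both $|G(u)|$ and $|e^{-u} G(-u)|$ are
    at most $4|u|^{2/3}$. Thus $|fg|^2$ and $|\psi g|^2$ are bounded by $16 |1-z^2|^{-2/3}$, whose
    integrals over the circles of radius less than 1 are uniformly bounded: both functions lie in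
    $H^2(|g|^2)$.

  \<^item> All summands of $G(u)$ have nonnegative real part, so no cancellation can occur. On the arc of
    length $t_n$ starting at the point $1-t_n$ of the circle of that radius, the real part of $u$ is
    at least $1/(4t_n)$, so $|f|$ is at least a fixed multiple of $c_n$. The square mean over the
    circle is therefore at least a fixed multiple of $c_n^2 t_n = 4^n$, and $f \notin H^2$.

  The geometric choice of $c_n$ and $t_n$ only serves to make $c_n t_n^{2/3}$ summable while
  $c_n^2 t_n$ is unbounded.

  Every integral estimate, including the Muckenhoupt condition, reduces to one bound: the integral of
  $|\sin(t/2)|^{-2/3}$ over an interval of length $L \le 2\pi$ is at most a constant times $L^{1/3}$.
  That $g$ is outer is the Schwarz formula for $\log(1-z)$, which is the limit of the formulas for
  $\log(1-\rho z)$, $\rho < 1$.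
\<close>

section \<open>The integral of an inverse 2/3 power of the sine\<close>

text \<open>
  The cube root is Hoelder continuous of order 1/3: with $p$ and $q$ the two roots and $d = q - p$,
  the inequality is $d^3 \le 8 (q^3 - p^3)$.
\<close>

lemma root3_diff_le:
  assumes "x \<le> y"
  shows "root 3 y - root 3 x \<le> 2 * root 3 (y - x)"
proof -
  define p q d where "p = root 3 x" and "q = root 3 y" and "d = root 3 y - root 3 x"
  have p: "p ^ 3 = x" and q: "q ^ 3 = y" by (simp_all add: p_def q_def odd_real_root_pow)
  have d: "d \<ge> 0" "d = q - p" using assms by (simp_all add: d_def p_def q_def)
  have "8 * (y - x) - d ^ 3 = d * (7 * d\<^sup>2 + 24 * p * q)"
    by (simp add: p[symmetric] q[symmetric] d(2) power2_eq_square power3_eq_cube algebra_simps)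
  also have "\<dots> = d * (d\<^sup>2 + 6 * (p + q)\<^sup>2)"
    by (simp add: d(2) power2_eq_square algebra_simps)
  also have "\<dots> \<ge> 0" using d(1) by simp
  finally have "d ^ 3 \<le> (2 ^ 3) * (y - x)" by simp
  then have "root 3 (d ^ 3) \<le> root 3 (2 ^ 3 * (y - x))" by simp
  also have "\<dots> = 2 * root 3 (y - x)"
      by (simp only: real_root_mult odd_real_root_power_cancel) (simp add: odd_real_root_power_cancel)
  finally show ?thesis by (simp add: odd_real_root_power_cancel d_def)
qed

text \<open>
  The primitive $3 (t-c)^{1/3}$ is continuous across its only bad point $c$, so the fundamental
  theorem of calculus applies on the whole interval. Bounding its increment by the length alone gives
  an estimate that is uniform in the position of $c$.
\<close>

lemma nn_integral_abs_powr:
  assumes "a \<le> b"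
  shows "(\<integral>\<^sup>+t\<in>{a..b}. ennreal (\<bar>t - c\<bar> powr (-2/3))
      \<partial>lebesgue) \<le> ennreal (6 * root 3 (b - a))"
proof -
  let ?f = "\<lambda>t. \<bar>t - c\<bar> powr (-2/3)" and ?F = "\<lambda>t. 3 * root 3 (t - c)"
  have der: "(?F has_vector_derivative ?f t) (at t)" if "t \<noteq> c" for t
  proof -
    have "root 3 (t - c) ^ 2 = \<bar>root 3 (t-c)\<bar> powr 2" using that by (simp add: powr_numeral)
    also have "\<bar>root 3 (t-c)\<bar> = \<bar>t-c\<bar> powr (1/3)" using that
      by (simp add: real_root_abs[symmetric] root_powr_inverse)
    finally have "inverse (root 3 (t - c) ^ 2) = ?f t"
      by (simp add: powr_powr powr_minus)
    moreover have "(?F has_real_derivative 3 * (inverse (real 3 * root 3 (t - c) ^ (3 - Suc 0)))) (at t)"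
      using that by (auto intro!: derivative_eq_intros DERIV_chain2[OF DERIV_odd_real_root] )
    ultimately show ?thesis
      by (simp add: has_real_derivative_iff_has_vector_derivative numeral_2_eq_2)
  qed
  have I: "(?f has_integral (?F b - ?F a)) {a..b}"
    by (rule fundamental_theorem_of_calculus_interior_strong[of "{c}"])
       (use assms der in \<open>auto intro!: continuous_intros\<close>)
  have "(\<integral>\<^sup>+t\<in>{a..b}. ennreal (?f t) \<partial>lebesgue) = ennreal (?F b - ?F a)"
    using nn_integral_has_integral_lebesgue'[OF _ I] by (simp add: nn_integral_completion)
  also have "\<dots> \<le> ennreal (6 * root 3 (b - a))"
    using root3_diff_le[of "a - c" "b - c"] assms by (intro ennreal_leI) simp
  finally show ?thesis .
qed

text \<open>
  Up to a constant factor this is $|1-e^{it}|^{-2/3}$, the inverse of the weight. It is 0 instead of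
  infinite at the multiples of $2\pi$, which is harmless as they form a null set.
\<close>

definition sin_half_powr :: "real \<Rightarrow> real" where
  "sin_half_powr t = \<bar>sin (t / 2)\<bar> powr (-2/3)"

lemma sin_half_powr_nonneg [simp]: "sin_half_powr t \<ge> 0" by (simp add: sin_half_powr_def)

lemma borel_measurable_sin_half_powr [measurable]: "sin_half_powr \<in> borel_measurable borel"
  unfolding sin_half_powr_def by measurable

text \<open>
  On one period the sine lies above the chords joining its zeros to its maximum, by concavity; the
  two terms belong to the zeros at the two ends.
\<close>

lemma sin_half_powr_le_period:
  assumes "0 \<le> x" "x \<le> 2 * pi"
  shows "sin_half_powr x \<le> 3 * \<bar>x\<bar> powr (-2/3) + 3 * \<bar>x - 2 * pi\<bar> powr (-2/3)"
proof -
  have pi3: "pi powr (2/3) \<le> 3"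
  proof -
    have "pi powr (2/3) \<le> 4 powr (2/3)" using pi_less_4 by (intro powr_mono2) auto
    also have "(4::real) powr (2/3) = (4 powr 2) powr (1/3)" by (simp only: powr_powr) simp
    also have "\<dots> \<le> 27 powr (1/3)" by (intro powr_mono2) (auto simp: powr_numeral)
    also have "\<dots> = (3 powr 3) powr (1/3)" by (simp add: powr_numeral)
    also have "\<dots> = 3" by (simp only: powr_powr) simp
    finally show ?thesis .
  qed
  have key: "\<bar>sin (y / 2)\<bar> powr (-2/3) \<le> 3 * y powr (-2/3)"
      if "0 \<le> y" "y \<le> pi" for y :: real
  proof (cases "y = 0")
    case False
    have "y / pi \<le> sin (y / 2)"
    proof -
      have "concave_on {0..pi} sin"
        by (rule f''_le0_imp_concave[where f' = cos and f'' = "\<lambda>x. - sin x"])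
           (auto intro!: derivative_eq_intros sin_ge_zero)
      from concave_onD[OF this, of "y/pi" 0 "pi/2"] that show ?thesis
        by (simp add: field_simps)
    qed
    moreover have "0 < y / pi" using that False by simp
    ultimately have "\<bar>sin (y / 2)\<bar> powr (-2/3) \<le> (y / pi) powr (-2/3)"
      by (intro powr_mono2') auto
    also have "\<dots> = pi powr (2/3) * y powr (-2/3)"
      using that by (simp add: powr_divide powr_minus field_simps)
    also have "\<dots> \<le> 3 * y powr (-2/3)" using pi3 by (intro mult_right_mono) auto
    finally show ?thesis .
  qed simp
  show ?thesis
  proof (cases "x \<le> pi")
    case True
    then show ?thesis using key[of x] assms by (auto simp: sin_half_powr_def intro: order_trans)
  next
    case False
    have "sin ((2*pi - x) / 2) = sin (x/2)" using sin_pi_minus[of "x/2"]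
        by (simp add: diff_divide_distrib)
    then show ?thesis using key[of "2*pi - x"] assms False
      by (simp add: sin_half_powr_def add_increasing)
  qed
qed

lemma sin_half_powr_periodic: "sin_half_powr (t + 2 * pi * of_int k) = sin_half_powr t"
proof -
  have "\<bar>sin (t/2 + pi * of_int k)\<bar> = \<bar>sin (t/2)\<bar>"
    by (simp add: sin_add abs_mult cos_npi_int sin_npi_int)
  then show ?thesis by (simp add: sin_half_powr_def add_divide_distrib)
qed

text \<open>
  An interval of length at most $2\pi$ that starts in a period ends at the latest in the following
  one, so three consecutive zeros account for the whole singularity on it.
\<close>

lemma sin_half_powr_le_near:
  fixes k :: int
  assumes "2 * pi * k \<le> t" "t \<le> 2 * pi * k + 4 * pi"
  shows "sin_half_powr t \<le> (\<Sum>j\<in>{k,k+1,k+2}. 3 * \<bar>t - 2 * pi * of_int j\<bar> powr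
      (-2/3))"
proof -
  have *: "sin_half_powr t \<le> 3 * \<bar>t - 2 * pi * j\<bar> powr (-2/3)
      + 3 * \<bar>t - 2 * pi * (j+1)\<bar> powr (-2/3)"
    if "2 * pi * j \<le> t" "t \<le> 2 * pi * j + 2 * pi" for j :: int
    using sin_half_powr_le_period[of "t - 2 * pi * j"] sin_half_powr_periodic[of "t - 2 * pi * j" j] that
    by (simp add: algebra_simps)
  show ?thesis
  proof (cases "t \<le> 2 * pi * k + 2 * pi")
    case True
    have "0 \<le> 3 * \<bar>t - 2 * pi * (of_int k + 2)\<bar> powr (-2/3)" by simp
    from add_mono[OF *[of k] this] show ?thesis using True assms by (simp add: add.assoc)
  next
    case False
    have "2 * pi * of_int (k + 1) \<le> t" "t \<le> 2 * pi * of_int (k + 1) + 2 * pi"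
      using False assms by (simp_all add: algebra_simps)
    note h = *[OF this]
    have "0 \<le> 3 * \<bar>t - 2 * pi * of_int k\<bar> powr (-2/3)" by simp
    from add_mono[OF this h] show ?thesis by (simp add: add.assoc)
  qed
qed

lemma nn_integral_sin_half_powr:
  assumes "a \<le> b" "b \<le> a + 2 * pi"
  shows "(\<integral>\<^sup>+t\<in>{a..b}. ennreal (sin_half_powr t) \<partial>lebesgue)
      \<le> ennreal (54 * root 3 (b - a))"
proof -
  define k where "k = \<lfloor>a / (2 * pi)\<rfloor>"
  have k: "2 * pi * k \<le> a" "a \<le> 2 * pi * k + 2 * pi"
  proof -
    have "of_int k \<le> a / (2 * pi)" "a / (2 * pi) \<le> of_int k + 1"
      unfolding k_def by linarith+
    then show "2 * pi * k \<le> a" "a \<le> 2 * pi * k + 2 * pi"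
      by (simp_all add: pos_le_divide_eq pos_divide_le_eq algebra_simps)
  qed
  have meas: "(\<lambda>t. ennreal (\<bar>t - c\<bar> powr (-2/3)) * indicator {a..b} t)
      \<in> borel_measurable lebesgue" for c
  proof -
    have "(\<lambda>t. ennreal (\<bar>t - c\<bar> powr (-2/3)) * indicator {a..b} t)
        \<in> borel_measurable lborel" by measurable
    then show ?thesis by (rule measurable_completion)
  qed
  have "(\<integral>\<^sup>+t\<in>{a..b}. ennreal (sin_half_powr t) \<partial>lebesgue)
     \<le> (\<integral>\<^sup>+t. (\<Sum>j\<in>{k,k+1,k+2}. 3 * (ennreal (\<bar>t - 2 * pi * of_int
         j\<bar> powr (-2/3)) * indicator {a..b} t)) \<partial>lebesgue)"
  proof (rule nn_integral_mono)
    fix t :: real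
    show "ennreal (sin_half_powr t) * indicator {a..b} t \<le>
      (\<Sum>j\<in>{k,k+1,k+2}. 3 * (ennreal (\<bar>t - 2 * pi * of_int j\<bar> powr (-2/3)) *
          indicator {a..b} t))"
    proof (cases "t \<in> {a..b}")
      case True
      then have "ennreal (sin_half_powr t)
          \<le> ennreal (\<Sum>j\<in>{k,k+1,k+2}. 3 * \<bar>t - 2 * pi * of_int j\<bar> powr (-2/3))"
        using k assms by (intro ennreal_leI sin_half_powr_le_near) auto
      also have "\<dots> = (\<Sum>j\<in>{k,k+1,k+2}. 3 * ennreal (\<bar>t - 2 * pi * of_int j\<bar>
          powr (-2/3)))"
        by (simp add: sum_ennreal[symmetric] ennreal_mult ennreal_plus)
      finally show ?thesis using True by simp
    qed simp
  qed
  also have "\<dots> = (\<Sum>j\<in>{k,k+1,k+2}. 3 * (\<integral>\<^sup>+t\<in>{a..b}. ennreal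
      (\<bar>t - 2 * pi * of_int j\<bar> powr (-2/3)) \<partial>lebesgue))"
    by (simp only: nn_integral_sum[OF borel_measurable_times_ennreal[OF borel_measurable_const meas]]
        nn_integral_cmult[OF meas])
  also have "\<dots> \<le> (\<Sum>j\<in>{k,k+1,k+2}. 3 * ennreal (6 * root 3 (b - a)))"
    using assms by (intro sum_mono mult_left_mono nn_integral_abs_powr) auto
  also have "\<dots> = ennreal (54 * root 3 (b - a))"
  proof -
    have "3 * ennreal (6 * root 3 (b - a)) = ennreal (18 * root 3 (b - a))"
      using assms by (simp add: ennreal_mult[symmetric] flip: ennreal_numeral)
    then have "(\<Sum>j\<in>{k,k+1,k+2}. 3 * ennreal (6 * root 3 (b - a))) =
        (\<Sum>j\<in>{k,k+1,k+2}. ennreal (18 * root 3 (b - a)))"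
      by simp
    also have "\<dots> = ennreal (\<Sum>j\<in>{k,k+1,k+2}. 18 * root 3 (b - a))"
      using assms by (intro sum_ennreal) simp
    also have "(\<Sum>j\<in>{k,k+1,k+2}. 18 * root 3 (b - a)) = 54 * root 3 (b - a)" by simp
    finally show ?thesis .
  qed
  finally show ?thesis .
qed

lemma AE_sin_nonzero: "AE t::real in lebesgue. sin t \<noteq> 0"
proof -
  have "countable {t::real. sin t = 0}"
  proof (rule countable_subset)
    show "{t::real. sin t = 0} \<subseteq> range (\<lambda>i::int. of_int i * pi)"
        by (auto simp: sin_zero_iff_int2)
  qed simp
  then have "{t::real. sin t = 0} \<in> null_sets lebesgue"
    by (intro null_sets_completionI countable_imp_null_set_lborel)
  then show ?thesis by (rule AE_I') auto
qed

lemma AE_sin_half_nonzero: "AE t::real in lebesgue. sin (t / 2) \<noteq> 0"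
  using AE_sin_nonzero
proof eventually_elim
  case (elim t)
  have "sin t = 2 * sin (t/2) * cos (t/2)" using sin_double[of "t/2"] by simp
  with elim show ?case by auto
qed

lemma norm_one_minus_cis: "norm (1 - cis t) = 2 * \<bar>sin (t / 2)\<bar>"
proof -
  have "(norm (1 - cis t))\<^sup>2 = (2 * \<bar>sin (t / 2)\<bar>)\<^sup>2"
  proof -
    have "(norm (1 - cis t))\<^sup>2 = 2 - 2 * cos t"
      unfolding cmod_power2 by (simp add: power2_eq_square algebra_simps)
    also have "\<dots> = (2 * \<bar>sin (t / 2)\<bar>)\<^sup>2" using cos_double_sin[of "t/2"]
        by (simp add: power_mult_distrib)
    finally show ?thesis .
  qed
  then show ?thesis by (rule power2_eq_imp_eq) auto
qed

section \<open>The Muckenhoupt condition\<close>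

text \<open>
  The function $s(t) = |\sin(t/2)|$ is Lipschitz. On an interval whose length is small compared to
  $s$ at its left end, $s$ is constant up to a factor and there is nothing to integrate. Otherwise $s$
  is bounded on the interval by a multiple of its length $L$, so the average of the weight is at most
  of order $L^{2/3}$, and that of its inverse is at most of order $L^{1/3}/L$.
\<close>

lemma muckenhoupt_cbrt: "muckenhoupt_A2 (\<lambda>z. norm (1 - z) powr (2/3))"
proof -
  define s where "s t = \<bar>sin (t / 2)\<bar>" for t :: real
  define w where "w t = norm (1 - cis t) powr (2/3)" for t
  have w: "w t = (2 * s t) powr (2/3)" for t
    by (simp add: w_def s_def norm_one_minus_cis)
  have w_le: "w t \<le> 2 * s t powr (2/3)" for t
  proof -
    have "w t = 2 powr (2/3) * s t powr (2/3)" by (simp add: w powr_mult s_def)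
    also have "\<dots> \<le> 2 powr 1 * s t powr (2/3)" by (intro mult_right_mono powr_mono) auto
    finally show ?thesis by simp
  qed
  have inv_le: "inverse (w t) \<le> sin_half_powr t" for t
  proof -
    have "inverse (w t) = 2 powr (-2/3) * sin_half_powr t"
      by (simp add: w powr_mult s_def sin_half_powr_def powr_minus)
    also have "\<dots> \<le> 2 powr 0 * sin_half_powr t" by (intro mult_right_mono powr_mono) auto
    finally show ?thesis by simp
  qed
  have lip: "\<bar>s x - s y\<bar> \<le> \<bar>x - y\<bar>" for x y
  proof -
    have "\<bar>s x - s y\<bar> \<le> \<bar>sin (x/2) - sin (y/2)\<bar>"
        by (simp add: s_def abs_triangle_ineq3)
    also have "\<dots> \<le> 1 * \<bar>x/2 - y/2\<bar>"
      using field_differentiable_bound[of UNIV sin cos 1 "x/2" "y/2"]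
      by (auto intro!: derivative_eq_intros)
    finally show ?thesis by (simp add: abs_if split: if_splits)
  qed
  have avg_const: "(\<integral>\<^sup>+t\<in>{a..b}. ennreal (h t)
      \<partial>lebesgue) / ennreal (b - a) \<le> ennreal m"
    if "a < b" "\<And>t. t \<in> {a..b} \<Longrightarrow> h t \<le> m"
        for a b m :: real and h :: "real \<Rightarrow> real"
  proof -
    have "(\<integral>\<^sup>+t\<in>{a..b}. ennreal (h t) \<partial>lebesgue)
        \<le> (\<integral>\<^sup>+t. ennreal m * indicator {a..b} t \<partial>lebesgue)"
      using that by (intro nn_integral_mono) (auto simp: indicator_def intro!: ennreal_leI)
    also have "\<dots> = ennreal m * ennreal (b - a)"
      using that by (subst nn_integral_cmult_indicator) auto
    finally have "(\<integral>\<^sup>+t\<in>{a..b}. ennreal (h t)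
        \<partial>lebesgue) / ennreal (b - a) \<le> ennreal m * ennreal (b - a) / ennreal (b - a)"
      by (rule divide_right_mono_ennreal)
    also have "\<dots> = ennreal m" using that by (intro ennreal_mult_divide_eq) auto
    finally show ?thesis .
  qed
  have main: "((\<integral>\<^sup>+t\<in>{a..b}. ennreal (w t) \<partial>lebesgue) / ennreal (b - a)) *
        ((\<integral>\<^sup>+t\<in>{a..b}. ennreal (inverse (w t))
            \<partial>lebesgue) / ennreal (b - a)) \<le> ennreal 324"
    (is "?A * ?B \<le> _")
    if ab: "a < b" "b \<le> a + 2 * pi" for a b
  proof (cases "s a \<ge> 2 * (b - a)")
    case True
    have s: "s a / 2 \<le> s t" "s t \<le> 3 * s a / 2" if "t \<in> {a..b}" for t
      using lip[of a t] True that by auto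
    have sa: "s a > 0" using True ab by simp
    have A: "?A \<le> ennreal ((3 * s a) powr (2/3))"
    proof (intro avg_const ab)
      fix t assume "t \<in> {a..b}"
      from s(2)[OF this] show "w t \<le> (3 * s a) powr (2/3)"
        unfolding w by (intro powr_mono2) (auto simp: s_def)
    qed
    have B: "?B \<le> ennreal ((s a) powr (-2/3))"
    proof (intro avg_const ab)
      fix t assume "t \<in> {a..b}"
      from s[OF this] sa show "inverse (w t) \<le> s a powr (-2/3)"
        unfolding w by (simp add: powr_minus[symmetric] powr_mono2')
    qed
    have "?A * ?B \<le> ennreal ((3 * s a) powr (2/3)) * ennreal ((s a) powr (-2/3))"
      by (intro mult_mono A B) auto
    also have "\<dots> = ennreal (3 powr (2/3))"
      using sa by (simp add: ennreal_mult[symmetric] powr_mult powr_minus)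
    also have "\<dots> \<le> ennreal 324"
      using powr_mono[of "2/3" 1 "3::real"] by (intro ennreal_leI) auto
    finally show ?thesis .
  next
    case False
    have s: "s t \<le> 3 * (b - a)" if "t \<in> {a..b}" for t
      using lip[of a t] False that by auto
    have A: "?A \<le> ennreal (6 * (b - a) powr (2/3))"
    proof (intro avg_const ab)
      fix t assume t: "t \<in> {a..b}"
      have "s t powr (2/3) \<le> (3 * (b - a)) powr (2/3)"
        using s[OF t] by (intro powr_mono2) (auto simp: s_def)
      also have "\<dots> = 3 powr (2/3) * (b - a) powr (2/3)" using ab by (subst powr_mult) auto
      also have "\<dots> \<le> 3 powr 1 * (b - a) powr (2/3)"
        by (intro mult_right_mono powr_mono) auto
      finally show "w t \<le> 6 * (b - a) powr (2/3)" using w_le[of t] by simp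
    qed
    have "(\<integral>\<^sup>+t\<in>{a..b}. ennreal (inverse (w t)) \<partial>lebesgue)
        \<le> (\<integral>\<^sup>+t\<in>{a..b}. ennreal (sin_half_powr t) \<partial>lebesgue)"
      by (intro nn_integral_mono mult_right_mono ennreal_leI inv_le) auto
    also have "\<dots> \<le> ennreal (54 * root 3 (b - a))" using ab
        by (intro nn_integral_sin_half_powr) auto
    finally have "?B \<le> ennreal (54 * root 3 (b - a)) / ennreal (b - a)"
      by (rule divide_right_mono_ennreal)
    also have "\<dots> = ennreal (54 * (b - a) powr (-2/3))"
    proof -
      have "root 3 (b - a) / (b - a) = (b - a) powr (1/3) / (b - a) powr 1"
        using ab by (simp add: root_powr_inverse)
      also have "\<dots> = (b - a) powr (-2/3)" unfolding powr_diff[symmetric] by simp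
      finally show ?thesis using ab by (simp add: divide_ennreal)
    qed
    finally have B: "?B \<le> ennreal (54 * (b - a) powr (-2/3))" .
    have "?A * ?B \<le> ennreal (6 * (b - a) powr (2/3)) * ennreal (54 * (b - a) powr (-2/3))"
      by (intro mult_mono A B) auto
    also have "\<dots> = ennreal 324"
      using ab by (simp add: ennreal_mult[symmetric] powr_minus)
    finally show ?thesis .
  qed
  have "w \<in> borel_measurable lborel"
    unfolding w s_def by measurable
  then have meas: "w \<in> borel_measurable lebesgue" by (rule measurable_completion)
  have pos: "AE t in lebesgue. w t > 0"
    using AE_sin_half_nonzero by eventually_elim (simp add: w s_def)
  have "(SUP (a, b) \<in> {(a::real, b). a < b \<and> b \<le> a + 2 * pi}.
        ((\<integral>\<^sup>+t\<in>{a..b}. ennreal (w t) \<partial>lebesgue) / ennreal (b - a)) *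
        ((\<integral>\<^sup>+t\<in>{a..b}. ennreal (inverse (w t))
            \<partial>lebesgue) / ennreal (b - a))) \<le> ennreal 324"
    using main by (intro SUP_least) auto
  also have "\<dots> < \<infinity>" by simp
  finally show ?thesis using meas pos unfolding muckenhoupt_A2_def w_def
      by (simp add: top.not_eq_extremum)
qed

section \<open>The function $(1-z)^{1/3}$ is outer\<close>

lemma integral_circle_holomorphic:
  assumes "f holomorphic_on S" "open S" "cball 0 1 \<subseteq> S"
  shows "((\<lambda>t. f (cis t)) has_integral 2 * of_real pi * f 0) {0..2*pi}"
proof -
  have c: "continuous_on (cball 0 1) f"
    using assms by (meson continuous_on_subset holomorphic_on_imp_continuous_on)
  have h: "f holomorphic_on ball 0 1"
    using assms by (meson ball_subset_cball holomorphic_on_subset order_trans)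
  have "((\<lambda>u. f u / (u - 0)) has_contour_integral (2 * of_real pi * \<i> * f 0)) (circlepath 0 1)"
    by (rule Cauchy_integral_circlepath[OF c h]) simp
  then have "((\<lambda>t. f (0 + of_real 1 * cis t) / (0
      + of_real 1 * cis t - 0) * of_real 1 * \<i> * cis t)
      has_integral (2 * of_real pi * \<i> * f 0)) {0..2*pi}"
    unfolding circlepath_def by (subst (asm) has_contour_integral_part_circlepath_iff) auto
  then have "((\<lambda>t. \<i> * f (cis t)) has_integral (2 * of_real pi * \<i> * f 0)) {0..2*pi}"
    by (simp add: mult.commute)
  from has_integral_mult_right[OF this, of "-\<i>"] show ?thesis
    by (rule has_integral_eq_rhs[OF has_integral_eq, rotated]) (simp_all add: complex_eq_iff)
qed

text \<open>
  Recovers a holomorphic function that is real at 0 from its real part on the circle. With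
  $k = (\zeta+z)/(\zeta-z)$ and $2 \Re h = h + \overline h$, the integral of $k h$ comes from
  Cauchy's formula. That of $k \overline h$ is the conjugate of the integral of $\overline k h$, and
  $\overline k = (1+\overline z \zeta)/(1-\overline z \zeta)$ on the circle is again
  holomorphic in $\zeta$, so the mean value property applies.
\<close>

lemma schwarz_formula:
  assumes h: "h holomorphic_on S" and S: "open S" "cball 0 1 \<subseteq> S" and z: "norm z < 1"
    and h0: "Im (h 0) = 0"
  shows "((\<lambda>t. (cis t + z) / (cis t - z) * of_real (Re (h (cis t))))
      has_integral 2 * of_real pi * h z) {0..2*pi}"
proof -
  let ?k = "\<lambda>t. (cis t + z) / (cis t - z)"
  have ball: "cball 0 1 \<subseteq> S" by (fact S)
  have cont: "continuous_on (cball 0 1) h"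
    using h ball by (meson continuous_on_subset holomorphic_on_imp_continuous_on)
  have hol: "h holomorphic_on ball 0 1"
    using h ball by (meson ball_subset_cball holomorphic_on_subset order_trans)
  have ne: "cis t \<noteq> z" for t using z norm_cis[of t] by auto
  have 1: "((\<lambda>t. ?k t * h (cis t)) has_integral 2 * of_real pi * (2 * h z - h 0)) {0..2*pi}"
  proof -
    have "((\<lambda>u. h u / (u - z)) has_contour_integral (2 * of_real pi * \<i> * h z))
        (circlepath 0 1)"
      by (rule Cauchy_integral_circlepath[OF cont hol]) (use z in auto)
    then have "((\<lambda>t. h (0 + of_real 1 * cis t) / (0
        + of_real 1 * cis t - z) * of_real 1 * \<i> * cis t)
        has_integral (2 * of_real pi * \<i> * h z)) {0..2*pi}"
      unfolding circlepath_def by (subst (asm) has_contour_integral_part_circlepath_iff) auto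
    from has_integral_mult_right[OF this, of "-2*\<i>"]
    have A: "((\<lambda>t. 2 * cis t / (cis t - z) * h (cis t))
        has_integral 4 * of_real pi * h z) {0..2*pi}"
      by (simp add: algebra_simps)
    from has_integral_diff[OF A integral_circle_holomorphic[OF h S]]
    show ?thesis
    proof (rule has_integral_eq_rhs[OF has_integral_eq, rotated])
      fix t
      show "2 * cis t / (cis t - z) * h (cis t) - h (cis t) = ?k t * h (cis t)"
        using ne[of t] by (simp add: field_simps)
    qed (simp add: algebra_simps)
  qed
  have 2: "((\<lambda>t. cnj (?k t) * h (cis t)) has_integral 2 * of_real pi * h 0) {0..2*pi}"
  proof -
    define S' where "S' = S \<inter> {w. cnj z * w \<noteq> 1}"
    have S': "open S'" unfolding S'_def
      by (intro open_Int S open_Collect_neq continuous_intros)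
    have sub: "cball 0 1 \<subseteq> S'"
    proof
      fix w :: complex assume w: "w \<in> cball 0 1"
      then have "norm (cnj z * w) \<le> norm z" by (simp add: norm_mult mult_left_le)
      then have "cnj z * w \<noteq> 1" using z by auto
      then show "w \<in> S'" using w ball by (auto simp: S'_def)
    qed
    have hol': "(\<lambda>w. (1 + cnj z * w) / (1 - cnj z * w) * h w) holomorphic_on S'"
      unfolding S'_def by (intro holomorphic_intros holomorphic_on_subset[OF h]) auto
    have eq: "(1 + cnj z * cis t) / (1 - cnj z * cis t) = cnj (?k t)" for t
    proof -
      have "cnj (?k t) = (cis (-t) + cnj z) / (cis (-t) - cnj z)" by (simp add: cis_cnj)
      also have "\<dots> = (cis t * (cis (-t) + cnj z)) / (cis t * (cis (-t) - cnj z))" by simp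
      also have "\<dots> = (1 + cnj z * cis t) / (1 - cnj z * cis t)"
        by (simp add: distrib_left right_diff_distrib cis_mult mult.commute)
      finally show ?thesis by simp
    qed
    from integral_circle_holomorphic[OF hol' S' sub] show ?thesis by (simp add: eq)
  qed
  have "((\<lambda>t. cnj (cnj (?k t) * h (cis t))) has_integral cnj (2 * of_real pi * h 0)) {0..2*pi}"
    using has_integral_linear[OF 2 bounded_linear_cnj] by (simp only: o_def)
  from has_integral_mult_right[OF has_integral_add[OF 1 this], of "1/2"]
  have 3: "((\<lambda>t. 1/2 * (?k t * h (cis t) + cnj (cnj (?k t) * h (cis t)))) has_integral
     1/2 * (2 * of_real pi * (2 * h z - h 0) + cnj (2 * of_real pi * h 0))) {0..2*pi}" .
  have "h 0 = cnj (h 0)" using h0 by (simp add: complex_eq_iff)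
  then have rhs: "1/2 * (2 * of_real pi * (2 * h z - h 0) + cnj (2 * of_real pi * h 0))
      = 2 * of_real pi * h z"
    by (simp add: algebra_simps)
  have "1/2 * (?k t * h (cis t) + cnj (cnj (?k t) * h (cis t))) = ?k t * of_real (Re (h (cis t)))" for t
  proof -
    have "1/2 * (k * a + cnj (cnj k * a)) = k * ((a + cnj a) / 2)" for k a :: complex
      by (simp add: algebra_simps)
    from this[of "?k t" "h (cis t)"]
    have "1/2 * (?k t * h (cis t) + cnj (cnj (?k t) * h (cis t)))
        = ?k t * ((h (cis t) + cnj (h (cis t))) / 2)" .
    also have "(h (cis t) + cnj (h (cis t))) / 2 = of_real (Re (h (cis t)))"
      by (simp add: complex_add_cnj)
    finally show ?thesis .
  qed
  then show ?thesis using 3 unfolding rhs by simp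
qed

text \<open>
  Radially uniform lower bound: the distance from $re^{it}$ to $e^{it}$ is $1-r$, which is at most
  its distance to 1.
\<close>

lemma norm_one_minus_ge:
  assumes "0 \<le> r" "r \<le> 1"
  shows "\<bar>sin (t / 2)\<bar> \<le> norm (1 - of_real r * cis t)"
proof -
  have "2 * \<bar>sin (t / 2)\<bar> = norm (1 - cis t)" by (simp add: norm_one_minus_cis)
  also have "\<dots> \<le> norm (1 - of_real r * cis t) + norm (of_real r * cis t - cis t)"
    by (rule order_trans[OF _ norm_triangle_ineq]) simp
  also have "norm (of_real r * cis t - cis t) = 1 - r"
  proof -
    have "of_real r * cis t - cis t = of_real (r - 1) * cis t" by (simp add: algebra_simps)
    then have "norm (of_real r * cis t - cis t) = \<bar>r - 1\<bar>"
        by (simp only: norm_mult norm_cis norm_of_real) simp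
    then show ?thesis using assms by simp
  qed
  also have "1 - r \<le> norm (1 - of_real r * cis t)"
    using norm_triangle_ineq2[of 1 "of_real r * cis t"] assms by (simp add: norm_mult)
  finally show ?thesis by simp
qed

text \<open>
  Dominates the logarithms on all circles of radius at most 1 at once; the negative part is bounded
  by $-\log x \le (3/2) x^{-2/3}$.
\<close>

lemma abs_ln_norm_le:
  assumes "0 \<le> r" "r \<le> 1" "sin (t / 2) \<noteq> 0"
  shows "\<bar>ln (norm (1 - of_real r * cis t))\<bar> \<le> 1 + 3/2 * sin_half_powr t"
proof -
  define x where "x = norm (1 - of_real r * cis t)"
  have x: "\<bar>sin (t / 2)\<bar> \<le> x" unfolding x_def by (intro norm_one_minus_ge assms)
  then have x0: "x > 0" using assms by linarith
  have "x \<le> 2" unfolding x_def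
    by (rule order_trans[OF norm_triangle_ineq4]) (use assms in \<open>simp add: norm_mult\<close>)
  then have "ln x \<le> 1" using ln_le_minus_one[OF x0] by simp
  moreover have "- ln x \<le> 3/2 * sin_half_powr t"
  proof -
    have "-2/3 * ln x = ln (x powr (-2/3))" using x0 by (simp add: ln_powr)
    also have "\<dots> \<le> x powr (-2/3)" using ln_le_minus_one[of "x powr (-2/3)"] x0 by simp
    also have "\<dots> \<le> sin_half_powr t" unfolding sin_half_powr_def using x assms(3)
        by (intro powr_mono2') auto
    finally show ?thesis by simp
  qed
  ultimately show ?thesis using sin_half_powr_nonneg[of t] unfolding x_def[symmetric] by linarith
qed

lemma set_integrable_sin_half_powr: "set_integrable lebesgue {0..2*pi} sin_half_powr"
  unfolding set_integrable_def
proof (rule integrableI_bounded)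
  have "(\<lambda>t. indicator {0..2*pi} t *\<^sub>R sin_half_powr t)
      \<in> borel_measurable lborel" by measurable
  then show "(\<lambda>t. indicator {0..2*pi} t *\<^sub>R sin_half_powr t)
      \<in> borel_measurable lebesgue"
    by (rule measurable_completion)
  have "(\<integral>\<^sup>+t. ennreal (norm (indicator {0..2*pi} t *\<^sub>R sin_half_powr t))
      \<partial>lebesgue) =
     (\<integral>\<^sup>+t\<in>{0..2*pi}. ennreal (sin_half_powr t) \<partial>lebesgue)"
    by (intro nn_integral_cong) (auto simp: indicator_def)
  also have "\<dots> \<le> ennreal (54 * root 3 (2*pi - 0))" by (rule nn_integral_sin_half_powr) auto
  also have "\<dots> < \<infinity>" by simp
  finally show "(\<integral>\<^sup>+t. ennreal (norm (indicator {0..2*pi} t *\<^sub>R sin_half_powr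
      t)) \<partial>lebesgue) < \<infinity>" .
qed

lemma measurable_log_kernel:
  "(\<lambda>t. indicator {0..2*pi} t *\<^sub>R ((cis t
      + z) / (cis t - z) * of_real (ln (norm (1 - of_real r * cis t))) :: complex))
     \<in> borel_measurable lebesgue"
proof -
  have [measurable]: "cis \<in> borel_measurable borel"
    by (intro borel_measurable_continuous_onI continuous_intros)
  have "(\<lambda>t. indicator {0..2*pi} t *\<^sub>R ((cis t
      + z) / (cis t - z) * of_real (ln (norm (1 - of_real r * cis t))) :: complex))
     \<in> borel_measurable lborel" by measurable
  then show ?thesis by (rule measurable_completion)
qed

text \<open>
  The Schwarz formula needs a function holomorphic across the circle, which $\log(1-z)$ is not at 1.
  It is applied to $\log(1-\rho z)$ instead, and dominated convergence takes $\rho$ to 1.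
\<close>

lemma poisson_schwarz_log:
  assumes z: "norm z < 1"
  shows "(LINT t:{0..2*pi}|lebesgue. (cis t + z) / (cis t - z) * of_real (ln (norm (1 - cis t)))) =
    2 * of_real pi * Ln (1 - z)"
proof -
  let ?k = "\<lambda>t. (cis t + z) / (cis t - z)"
  define \<rho> where "\<rho> n = 1 - 1 / real (n + 2)" for n
  have \<rho>: "0 \<le> \<rho> n" "\<rho> n < 1" for n by (auto simp: \<rho>_def field_simps)
  have \<rho>lim: "\<rho> \<longlonglongrightarrow> 1"
    unfolding \<rho>_def
    using tendsto_diff[OF tendsto_const LIMSEQ_ignore_initial_segment[OF lim_1_over_n], of 1 2] by simp
  define s where "s n t = indicator {0..2*pi} t *\<^sub>R (?k t * of_real (ln (norm (1 - of_real
      (\<rho> n) * cis t))))" for n t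
  define w where "w t = indicator {0..2*pi} t *\<^sub>R (2 / (1 - norm z) * (1
      + 3/2 * sin_half_powr t))" for t :: real
  have kb: "norm (?k t) \<le> 2 / (1 - norm z)" for t
  proof -
    have "norm (cis t + z) \<le> 2" by (rule order_trans[OF norm_triangle_ineq]) (use z in simp)
    moreover have "1 - norm z \<le> norm (cis t - z)" using norm_triangle_ineq2[of "cis t" z] by simp
    ultimately show ?thesis using z unfolding norm_divide by (intro frac_le) auto
  qed
  have w: "integrable lebesgue w"
  proof -
    have "set_integrable lebesgue {0..2*pi} (\<lambda>t. 2 / (1 - norm z) * (1 + 3/2 * sin_half_powr t))"
      by (intro set_integrable_mult_right set_integral_add set_integrable_sin_half_powr)
         (auto simp: set_integrable_def)
    then show ?thesis by (simp add: w_def[abs_def] set_integrable_def)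
  qed
  have bound: "AE t in lebesgue. norm (s n t) \<le> w t" for n
    using AE_sin_half_nonzero
  proof eventually_elim
    case (elim t)
    have "norm (?k t * of_real (ln (norm (1 - of_real (\<rho> n) * cis t))))
        \<le> 2 / (1 - norm z) * (1 + 3/2 * sin_half_powr t)"
      unfolding norm_mult norm_of_real
      by (intro mult_mono kb abs_ln_norm_le elim) (use \<rho>[of n] z in auto)
    then show ?case by (auto simp: s_def w_def indicator_def)
  qed
  have meas: "s n \<in> borel_measurable lebesgue" for n
    unfolding s_def by (rule measurable_log_kernel)
  define s' where "s' t = indicator {0..2*pi} t *\<^sub>R (?k t * of_real (ln (norm (1 - cis t))))" for t
  have meas': "s' \<in> borel_measurable lebesgue"
    using measurable_log_kernel[of z 1] unfolding s'_def by simp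
  have conv: "AE t in lebesgue. (\<lambda>n. s n t) \<longlonglongrightarrow> s' t"
    using AE_sin_half_nonzero
  proof eventually_elim
    case (elim t)
    then have "norm (1 - cis t) \<noteq> 0" unfolding norm_one_minus_cis by simp
    moreover have "(\<lambda>n. of_real (\<rho> n) :: complex) \<longlonglongrightarrow> of_real 1"
      by (intro tendsto_of_real \<rho>lim)
    then have "(\<lambda>n. norm (1 - of_real (\<rho> n) * cis t))
        \<longlonglongrightarrow> norm (1 - of_real 1 * cis t)"
      by (intro tendsto_norm tendsto_diff tendsto_mult tendsto_const)
    ultimately have "(\<lambda>n. ln (norm (1 - of_real (\<rho> n) * cis t)))
        \<longlonglongrightarrow> ln (norm (1 - cis t))"
      using tendsto_ln by fastforce
    then show ?case unfolding s_def s'_def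
      by (intro tendsto_scaleR tendsto_mult tendsto_of_real tendsto_const)
  qed
  have lim: "(\<lambda>n. integral\<^sup>L lebesgue (s n))
      \<longlonglongrightarrow> integral\<^sup>L lebesgue s'"
    by (rule integral_dominated_convergence[OF meas' meas w conv bound])
  have int: "integrable lebesgue (s n)" for n
    by (rule integrable_dominated_convergence2[OF meas' meas w conv bound])
  have val: "integral\<^sup>L lebesgue (s n) = 2 * of_real pi * Ln (1 - of_real (\<rho> n) * z)" for n
  proof -
    have "set_integrable lebesgue {0..2*pi} (\<lambda>t. ?k t * of_real (ln (norm (1 - of_real
        (\<rho> n) * cis t))))"
      using int[of n] by (simp add: set_integrable_def s_def[abs_def])
    from has_integral_set_lebesgue[OF this]
    have A: "((\<lambda>t. ?k t * of_real (ln (norm (1 - of_real (\<rho> n) * cis t))))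
        has_integral integral\<^sup>L lebesgue (s n)) {0..2*pi}"
      by (simp add: set_lebesgue_integral_def s_def[abs_def])
    define S where "S = {w::complex. Re (1 - of_real (\<rho> n) * w) > 0}"
    have "open S" unfolding S_def by (intro open_Collect_less continuous_intros)
    moreover have "cball 0 1 \<subseteq> S"
    proof
      fix w :: complex assume "w \<in> cball 0 1"
      then have "\<bar>Re w\<bar> \<le> 1" using abs_Re_le_cmod[of w] by simp
      then have "\<rho> n * Re w \<le> \<rho> n" using \<rho>[of n] by (simp add: mult_left_le)
      then show "w \<in> S" using \<rho>[of n] by (simp add: S_def)
    qed
    moreover have "(\<lambda>w. Ln (1 - of_real (\<rho> n) * w)) holomorphic_on S"
      by (intro holomorphic_intros) (auto simp: S_def complex_nonpos_Reals_iff)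
    ultimately have B: "((\<lambda>t. ?k t * of_real (Re (Ln (1 - of_real (\<rho> n) * cis t))))
        has_integral 2 * of_real pi * Ln (1 - of_real (\<rho> n) * z)) {0..2*pi}"
      by (intro schwarz_formula[where S = S] z) auto
    have "Re (Ln (1 - of_real (\<rho> n) * cis t)) = ln (norm (1 - of_real (\<rho> n) * cis t))" for t
    proof (rule Re_Ln)
      have "norm (of_real (\<rho> n) * cis t) < 1" using \<rho>[of n] by (simp add: norm_mult)
      then show "1 - of_real (\<rho> n) * cis t \<noteq> 0" by auto
    qed
    then show ?thesis using A B by (auto intro: has_integral_unique)
  qed
  have "(\<lambda>n. 2 * of_real pi * Ln (1 - of_real (\<rho> n) * z))
      \<longlonglongrightarrow> 2 * of_real pi * Ln (1 - of_real 1 * z)"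
  proof (intro tendsto_intros \<rho>lim)
    have "Re (1 - z) > 0" using z complex_Re_le_cmod[of z] by simp
    then show "1 - of_real 1 * z \<notin> \<real>\<^sub>\<le>\<^sub>0"
        by (auto simp: complex_nonpos_Reals_iff)
  qed
  from LIMSEQ_unique[OF lim[unfolded val] this]
  have "integral\<^sup>L lebesgue s' = 2 * of_real pi * Ln (1 - z)" by simp
  then show ?thesis by (simp add: set_lebesgue_integral_def s'_def[abs_def])
qed

lemma outer_cbrt: "outer_function (\<lambda>z. (1 - z) powr (1/3))"
  unfolding outer_function_def
\<comment> \<open>The modulus must be positive everywhere; the value 1 at the zero of $1-z$ agrees
    with the
  convention that the logarithm of 0 is 0.\<close>
proof (intro exI[of _ 1] exI[of _ "\<lambda>t. if cis t
    = 1 then 1 else norm (1 - cis t) powr (1/3)"] conjI allI ballI)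
  let ?\<phi> = "\<lambda>t. if cis t = 1 then 1 else norm (1 - cis t) powr (1/3)"
  have ln: "ln (?\<phi> t) = 1/3 * ln (norm (1 - cis t))" for t
    by (auto simp: ln_powr)
  show "set_integrable lebesgue {0..2*pi} (\<lambda>t. ln (?\<phi> t))"
    unfolding ln set_integrable_def
  proof (rule Bochner_Integration.integrable_bound)
    show "integrable lebesgue (\<lambda>t. indicator {0..2*pi} t *\<^sub>R (1 + 3/2 * sin_half_powr t))"
      unfolding set_integrable_def[symmetric]
      by (intro set_integrable_mult_right set_integral_add set_integrable_sin_half_powr) (auto simp:
          set_integrable_def)
    have [measurable]: "cis \<in> borel_measurable borel"
      by (intro borel_measurable_continuous_onI continuous_intros)
    have "(\<lambda>t. indicator {0..2*pi} t *\<^sub>R (1/3 * ln (norm (1 - cis t))))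
        \<in> borel_measurable lborel"
      by measurable
    then show "(\<lambda>t. indicator {0..2*pi} t *\<^sub>R (1/3 * ln (norm (1 - cis t))))
        \<in> borel_measurable lebesgue"
      by (rule measurable_completion)
    show "AE t in lebesgue. norm (indicator {0..2*pi} t *\<^sub>R (1/3 * ln (norm (1 - cis t))))
        \<le> norm (indicator {0..2*pi} t *\<^sub>R (1 + 3/2 * sin_half_powr t))"
      using AE_sin_half_nonzero
    proof eventually_elim
      case (elim t)
      then have "\<bar>ln (norm (1 - cis t))\<bar> \<le> 1 + 3/2 * sin_half_powr t"
          using abs_ln_norm_le[of 1 t] by simp
      then show ?case using sin_half_powr_nonneg[of t] by (auto simp: indicator_def abs_mult)
    qed
  qed
  fix z :: complex assume "z \<in> ball 0 1"
  then have z: "norm z < 1" by simp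
  then have "1 - z \<noteq> 0" by auto
  have "(LINT t:{0..2*pi}|lebesgue. (cis t + z) / (cis t - z) * of_real (ln (?\<phi> t))) =
     (LINT t:{0..2*pi}|lebesgue. (1/3) * ((cis t + z) / (cis t - z) * of_real (ln (norm (1 - cis t)))))"
    unfolding ln by (simp add: mult_ac)
  also have "\<dots> = 1/3 * (2 * of_real pi * Ln (1 - z))"
    by (subst set_integral_mult_right) (simp only: poisson_schwarz_log[OF z])
  finally have I: "(LINT t:{0..2*pi}|lebesgue. (cis t + z) / (cis t - z) * of_real (ln (?\<phi> t))) =
     1/3 * (2 * of_real pi * Ln (1 - z))" .
  show "(1 - z) powr (1/3) = 1 * exp (1 / (2 * of_real pi) *
      (LINT t:{0..2*pi}|lebesgue. (cis t + z) / (cis t - z) * of_real (ln (?\<phi> t))))"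
    unfolding I using \<open>1 - z \<noteq> 0\<close> by (simp add: powr_def)
qed auto

section \<open>A lacunary sum of exponentials\<close>

definition cayley :: "complex \<Rightarrow> complex" where
  "cayley z = (1 + z) / (1 - z)"

lemma Re_cayley: "Re (cayley z) = (1 - (norm z)\<^sup>2) / (norm (1 - z))\<^sup>2"
proof -
  have "Re (cayley z) = Re ((1 + z) * cnj (1 - z)) / (norm (1 - z))\<^sup>2"
    by (simp add: cayley_def complex_div_cnj[of "1 + z"] flip: of_real_power)
  also have "Re ((1 + z) * cnj (1 - z)) = 1 - (norm z)\<^sup>2"
    by (simp add: cmod_power2) (simp add: power2_eq_square algebra_simps)
  finally show ?thesis .
qed

lemma Re_cayley_pos: "norm z < 1 \<Longrightarrow> Re (cayley z) > 0"
  by (auto simp: Re_cayley power_less_one_iff abs_square_less_1 intro!: divide_pos_pos)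

lemma Re_cayley_cis: "Re (cayley (cis t)) = 0"
  by (simp add: Re_cayley)

lemma cayley_holomorphic: "cayley holomorphic_on - {1}"
  unfolding cayley_def by (intro holomorphic_intros) auto

definition lacunary_term :: "nat \<Rightarrow> complex \<Rightarrow> complex" where
  "lacunary_term n u = 128 ^ n * (1 - exp (- (u / 4096 ^ n)))"

text \<open>
  The sum converges for all $u$, so that both $G(u)$ and $G(-u)$ are available, although estimates of
  order $|u|^{2/3}$ hold only in a half-plane.
\<close>

definition lacunary_sum :: "complex \<Rightarrow> complex" where
  "lacunary_sum u = (\<Sum>n. lacunary_term n u)"

lemma norm_one_minus_exp_le:
  fixes w :: complex
  assumes "norm w \<le> R"
  shows "norm (1 - exp (- w)) \<le> exp R * norm w"
proof -
  have "norm (exp (- 0) - exp (- w)) \<le> exp R * norm (0 - w)"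
  proof (rule field_differentiable_bound[where S = "cball 0 R" and f' = "\<lambda>w. - exp (- w)"])
    show "0 \<in> cball 0 R" using assms norm_ge_zero[of w] by (simp del: norm_ge_zero)
    fix v :: complex assume "v \<in> cball 0 R"
    then show "norm (- exp (- v)) \<le> exp R" using abs_Re_le_cmod[of v] by simp
  qed (use assms in \<open>auto intro!: derivative_eq_intros\<close>)
  then show ?thesis by simp
qed

text \<open>
  In the half-plane the left side is at most 2 and at most $|w|$; the stated bound interpolates
  between the two.
\<close>

lemma norm_one_minus_exp_le_powr:
  fixes w :: complex
  assumes "Re w \<ge> 0"
  shows "norm (1 - exp (- w)) \<le> 2 * norm w powr (2/3)"
proof (cases "norm w \<le> 1")
  case True
  have "norm (exp (- 0) - exp (- w)) \<le> 1 * norm (0 - w)"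
  proof (rule field_differentiable_bound[where S = "{v. Re v \<ge> 0}" and f'
      = "\<lambda>w. - exp (- w)"])
    show "convex {v. Re v \<ge> 0}" by (rule convex_halfspace_Re_ge)
  qed (use assms in \<open>auto intro!: derivative_eq_intros\<close>)
  then have "norm (1 - exp (- w)) \<le> norm w powr 1" by simp
  also have "\<dots> \<le> norm w powr (2/3)" using True by (intro powr_mono') auto
  also have "\<dots> \<le> 2 * norm w powr (2/3)" by simp
  finally show ?thesis .
next
  case False
  have "norm (1 - exp (- w)) \<le> norm (1::complex) + norm (exp (- w))" by (rule norm_triangle_ineq4)
  also have "\<dots> \<le> 2" using assms by simp
  also have "\<dots> \<le> 2 * norm w powr (2/3)"
      using False ge_one_powr_ge_zero[of "norm w" "2/3"] by simp
  finally show ?thesis .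
qed

lemma norm_lacunary_term_le:
  assumes "norm u \<le> R"
  shows "norm (lacunary_term n u) \<le> (exp R * R) * (1/32) ^ n"
proof -
  have le: "norm (u / 4096 ^ n) \<le> norm u"
    by (simp add: norm_divide norm_power divide_le_eq mult_le_cancel_left1 one_le_power)
  have "norm (1 - exp (- (u / 4096 ^ n))) \<le> exp R * norm (u / 4096 ^ n)"
    by (rule norm_one_minus_exp_le) (use le assms in linarith)
  also have "\<dots> \<le> exp R * (R / 4096 ^ n)"
    using assms by (auto simp: norm_divide norm_power intro!: mult_left_mono divide_right_mono)
  finally have "norm (1 - exp (- (u / 4096 ^ n))) \<le> exp R * (R / 4096 ^ n)" .
  then have "128 ^ n * norm (1 - exp (- (u / 4096 ^ n))) \<le> 128 ^ n * (exp R * (R / 4096 ^ n))"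
    by (intro mult_left_mono) auto
  then have "norm (lacunary_term n u) \<le> 128 ^ n * (exp R * (R / 4096 ^ n))"
    by (simp only: lacunary_term_def norm_mult norm_power norm_numeral)
  also have "\<dots> = (exp R * R) * (128 ^ n / 4096 ^ n)" by simp
  also have "(128::real) ^ n / 4096 ^ n = (1/32) ^ n" by (simp flip: power_divide)
  finally show ?thesis .
qed

lemma summable_lacunary_term: "summable (\<lambda>n. lacunary_term n u)"
proof (rule summable_comparison_test')
  show "summable (\<lambda>n. (exp (norm u) * norm u) * (1/32) ^ n)"
    by (intro summable_mult summable_geometric) simp
qed (rule norm_lacunary_term_le, simp)

lemma lacunary_sum_holomorphic: "lacunary_sum holomorphic_on UNIV"
proof (rule holomorphic_uniform_sequence)
  show "(\<lambda>u. \<Sum>i<n. lacunary_term i u) holomorphic_on UNIV" for n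
    unfolding lacunary_term_def by (intro holomorphic_intros) auto
  fix x :: complex
  define R where "R = norm x + 1"
  have "uniform_limit (cball x 1) (\<lambda>n u. \<Sum>i<n. lacunary_term i u) lacunary_sum sequentially"
    unfolding lacunary_sum_def
  proof (rule Weierstrass_m_test)
    fix n u assume "u \<in> cball x 1"
    then have "norm u \<le> R" using norm_triangle_ineq2[of u x]
        by (simp add: R_def dist_norm norm_minus_commute)
    then show "norm (lacunary_term n u) \<le> (exp R * R) * (1/32) ^ n" by (rule norm_lacunary_term_le)
  qed (intro summable_mult summable_geometric, simp)
  then show "\<exists>d>0. cball x d
      \<subseteq> UNIV \<and> uniform_limit (cball x d) (\<lambda>n u. \<Sum>i<n. lacunary_term i u)
          lacunary_sum sequentially"
    by (intro exI[of _ 1]) auto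
qed simp

lemma cnj_lacunary_sum: "cnj (lacunary_sum u) = lacunary_sum (cnj u)"
proof -
  have "(\<lambda>n. lacunary_term n u) sums lacunary_sum u"
    unfolding lacunary_sum_def by (rule summable_sums[OF summable_lacunary_term])
  then have "(\<lambda>n. cnj (lacunary_term n u)) sums cnj (lacunary_sum u)" by (simp add: sums_cnj)
  then have "(\<lambda>n. lacunary_term n (cnj u)) sums cnj (lacunary_sum u)"
      by (simp add: lacunary_term_def exp_cnj)
  then show ?thesis unfolding lacunary_sum_def by (rule sums_unique)
qed

text \<open>
  The powers of 2 are chosen so that the exponent 2/3 yields a geometric series.
\<close>

lemma lacunary_term_bound_eq:
  "128 ^ n * (2 * norm (u / 4096 ^ n) powr (2/3)) = 2 * norm (u::complex) powr (2/3) * (1/2) ^ n"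
proof -
  have "((4096::real) ^ n) powr (2/3) = ((16 ^ n) powr 3) powr (2/3)"
    by (simp add: powr_numeral power_mult[symmetric] mult.commute[of n] power_mult)
  also have "\<dots> = 256 ^ n"
    by (simp only: powr_powr) (simp add: powr_numeral power_mult[symmetric] mult.commute[of n] power_mult)
  finally have "norm (u / 4096 ^ n) powr (2/3) = norm u powr (2/3) / 256 ^ n"
    by (simp add: norm_divide norm_power powr_divide)
  then have "128 ^ n * (2 * norm (u / 4096 ^ n) powr (2/3)) = 2 * norm u powr (2/3) * (128 ^ n / 256 ^ n)"
    by simp
  also have "(128::real) ^ n / 256 ^ n = (1/2) ^ n" by (simp flip: power_divide)
  finally show ?thesis .
qed

lemma norm_suminf_half_le:
  fixes h :: "nat \<Rightarrow> complex"
  assumes "\<And>n. norm (h n) \<le> 2 * K * (1/2) ^ n"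
  shows "norm (suminf h) \<le> 4 * K"
proof -
  have s: "(\<lambda>n. 2 * K * (1/2) ^ n) sums (2 * K * (1 / (1 - 1/2)))"
    by (intro sums_mult geometric_sums) simp
  have "norm (suminf h) \<le> (\<Sum>n. 2 * K * (1/2) ^ n)"
    using assms sums_summable[OF s] by (rule norm_suminf_le)
  then show ?thesis using sums_unique[OF s] by simp
qed

lemma norm_lacunary_sum_le:
  assumes "Re u \<ge> 0"
  shows "norm (lacunary_sum u) \<le> 4 * norm u powr (2/3)"
  unfolding lacunary_sum_def
proof (rule norm_suminf_half_le)
  fix n
  have "norm (1 - exp (- (u / 4096 ^ n))) \<le> 2 * norm (u / 4096 ^ n) powr (2/3)"
    using assms Re_divide_of_real[of u "4096 ^ n"] by (intro norm_one_minus_exp_le_powr) simp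
  then have "norm (lacunary_term n u) \<le> 128 ^ n * (2 * norm (u / 4096 ^ n) powr (2/3))"
    by (simp add: lacunary_term_def norm_mult norm_power)
  then show "norm (lacunary_term n u) \<le> 2 * norm u powr (2/3) * (1/2) ^ n"
    by (simp only: lacunary_term_bound_eq)
qed

text \<open>
  The exponentials of $G(-u)$ grow in the half-plane, but $e^{-u}$ outweighs them because the
  frequencies are at most 1: each summand becomes a decaying exponential $e^{-(u-v)}$ times a summand
  $1-e^{-v}$ of the kind bounded for $G(u)$.
\<close>

lemma norm_exp_lacunary_sum_le:
  assumes "Re u \<ge> 0"
  shows "norm (exp (- u) * lacunary_sum (- u)) \<le> 4 * norm u powr (2/3)"
proof -
  have "norm (\<Sum>n. exp (- u) * lacunary_term n (- u)) \<le> 4 * norm u powr (2/3)"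
  proof (rule norm_suminf_half_le)
    fix n
    define v where "v = u / 4096 ^ n"
    have Re_v: "Re v = Re u / 4096 ^ n"
      using Re_divide_of_real[of u "4096 ^ n"] by (simp add: v_def)
    have v: "0 \<le> Re v" "Re v \<le> Re u"
      using assms by (auto simp: Re_v divide_le_eq mult_le_cancel_left1 one_le_power)
    have "exp (- u) * lacunary_term n (- u) = - (128 ^ n * (exp (- (u - v)) * (1 - exp (- v))))"
      by (simp add: lacunary_term_def v_def[symmetric] algebra_simps flip: exp_add)
    then have "norm (exp (- u) * lacunary_term n (- u))
        = 128 ^ n * (exp (- (Re u - Re v)) * norm (1 - exp (- v)))"
      by (simp add: norm_mult norm_power)
    also have "\<dots> \<le> 128 ^ n * (1 * (2 * norm v powr (2/3)))"
      using v by (intro mult_left_mono mult_mono norm_one_minus_exp_le_powr) auto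
    finally show "norm (exp (- u) * lacunary_term n (- u)) \<le> 2 * norm u powr (2/3) * (1/2) ^ n"
      by (simp only: v_def mult_1 lacunary_term_bound_eq)
  qed
  then show ?thesis by (simp add: lacunary_sum_def suminf_mult[OF summable_lacunary_term])
qed

text \<open>
  Each $1-e^{-w}$ with $w$ in the half-plane has nonnegative real part, so a single summand already
  bounds the sum from below.
\<close>

lemma Re_lacunary_sum_ge:
  assumes "Re u \<ge> 0"
  shows "Re (lacunary_sum u) \<ge> 128 ^ n * (1 - exp (- (Re u / 4096 ^ n)))"
proof -
  have single: "Re (lacunary_term m u) \<ge> 128 ^ m * (1 - exp (- (Re u / 4096 ^ m)))" for m
  proof -
    have "Re (exp (- (u / 4096 ^ m))) \<le> norm (exp (- (u / 4096 ^ m)))" by (rule complex_Re_le_cmod)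
    also have "\<dots> = exp (- (Re u / 4096 ^ m))"
      using Re_divide_of_real[of u "4096 ^ m"] by simp
    finally have "128 ^ m * (1 - exp (- (Re u / 4096 ^ m)))
        \<le> 128 ^ m * Re (1 - exp (- (u / 4096 ^ m)))"
      by (intro mult_left_mono) auto
    also have "\<dots> = Re (of_real (128 ^ m) * (1 - exp (- (u / 4096 ^ m))))"
      by (simp only: times_complex.sel Re_complex_of_real Im_complex_of_real mult_zero_left diff_0_right)
    finally show ?thesis by (simp add: lacunary_term_def)
  qed
  have nonneg: "Re (lacunary_term m u) \<ge> 0" for m
    by (rule order_trans[OF _ single]) (use assms in auto)
  have sm: "summable (\<lambda>m. Re (lacunary_term m u))"
      by (rule summable_Re[OF summable_lacunary_term])
  have "Re (lacunary_term n u) \<le> (\<Sum>m. Re (lacunary_term m u))"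
    using sum_le_suminf[OF sm, of "{n}"] nonneg by simp
  also have "\<dots> = Re (lacunary_sum u)" unfolding lacunary_sum_def
    by (rule bounded_linear.suminf[OF bounded_linear_Re summable_lacunary_term, symmetric])
  finally show ?thesis using single[of n] by linarith
qed

section \<open>Boundary values and membership in Hardy spaces\<close>

lemma boundary_value_isCont:
  assumes "isCont f z"
  shows "boundary_value f z = f z"
proof -
  have "((\<lambda>r::real. of_real r * z) \<longlongrightarrow> of_real 1 * z) (at_left 1)"
    by (intro tendsto_intros)
  then have "((\<lambda>r::real. f (of_real r * z)) \<longlongrightarrow> f z) (at_left 1)"
    using isCont_tendsto_compose[OF assms] by simp
  then show ?thesis unfolding boundary_value_def by (intro tendsto_Lim) auto
qed

lemma boundary_value_holomorphic:
  assumes "f holomorphic_on S" "open S" "z \<in> S"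
  shows "boundary_value f z = f z"
  using assms by (intro boundary_value_isCont)
    (metis continuous_on_eq_continuous_at holomorphic_on_imp_continuous_on)

lemma norm_cbrt:
  fixes z :: complex
  shows "norm ((1 - z) powr (1/3)) = norm (1 - z) powr (1/3)"
  using norm_powr_real_powr'[of "1/3" "1 - z"] by simp

text \<open>
  At 1 the principal power is not continuous in the plane, but its modulus tends to 0 along the
  radius; elsewhere it is holomorphic across the circle.
\<close>

lemma norm_boundary_value_cbrt:
  "norm (boundary_value (\<lambda>w. (1 - w) powr (1/3)) (cis t)) = norm (1 - cis t) powr (1/3)"
proof (cases "cis t = 1")
  case True
  have "((\<lambda>r::real. \<bar>1 - r\<bar> powr (1/3)) \<longlongrightarrow> \<bar>1 - 1\<bar>
      powr (1/3)) (at_left 1)"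
    by (intro tendsto_powr2 tendsto_intros) auto
  moreover have "norm ((1 - of_real r * cis t) powr (1/3)) = \<bar>1 - r\<bar> powr (1/3)" for r :: real
  proof -
    have "norm (1 - of_real r :: complex) = \<bar>1 - r\<bar>"
      by (metis norm_of_real of_real_1 of_real_diff)
    then show ?thesis using True by (simp add: norm_cbrt)
  qed
  ultimately have "((\<lambda>r::real. (1 - of_real r * cis t) powr (1/3)) \<longlongrightarrow> 0)
      (at_left 1)"
    by (subst tendsto_norm_zero_iff[symmetric]) simp
  then have "boundary_value (\<lambda>w. (1 - w) powr (1/3)) (cis t) = 0"
    unfolding boundary_value_def by (intro tendsto_Lim) auto
  then show ?thesis using True by simp
next
  case False
  have "Re (cis t) \<noteq> 1"
  proof
    assume "Re (cis t) = 1"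
    moreover from this have "sin t = 0" using sin_cos_squared_add[of t] by simp
    ultimately show False using False by (simp add: complex_eq_iff)
  qed
  then have "Re (cis t) < 1" by (simp add: less_le)
  then have "boundary_value (\<lambda>w. (1 - w) powr (1/3)) (cis t) = (1 - cis t) powr (1/3)"
    by (intro boundary_value_holomorphic[where S
        = "{w. Re w < 1}"] open_halfspace_Re_lt holomorphic_intros)
       (auto simp: complex_nonpos_Reals_iff)
  then show ?thesis by (simp add: norm_cbrt)
qed

lemma hardy2I:
  fixes K :: "real \<Rightarrow> ennreal"
  assumes "f holomorphic_on ball 0 1"
    and le: "\<And>r. 0 \<le> r \<Longrightarrow> r < 1 \<Longrightarrow>
       AE t in lebesgue. t \<in> {0..2*pi} \<longrightarrow> ennreal ((norm (f (of_real r * cis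
           t)))\<^sup>2) \<le> K t"
    and fin: "(\<integral>\<^sup>+t\<in>{0..2*pi}. K t \<partial>lebesgue) \<le> ennreal C"
  shows "f \<in> hardy2"
  unfolding hardy2_def
proof (intro CollectI conjI assms(1) bdd_aboveI2)
  fix r :: real assume r: "r \<in> {0..<1}"
  have "(\<integral>\<^sup>+t. ennreal (indicator {0..2*pi} t *\<^sub>R (norm (f (of_real r * cis
      t)))\<^sup>2) \<partial>lebesgue) \<le>
     (\<integral>\<^sup>+t\<in>{0..2*pi}. K t \<partial>lebesgue)"
  proof (rule nn_integral_mono_AE)
    from r have "AE t in lebesgue. t
        \<in> {0..2*pi} \<longrightarrow> ennreal ((norm (f (of_real r * cis t)))\<^sup>2) \<le> K t"
      by (intro le) auto
    then show "AE t in lebesgue. ennreal (indicator {0..2*pi} t *\<^sub>R (norm (f (of_real r * cis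
        t)))\<^sup>2) \<le> K t * indicator {0..2*pi} t"
      by eventually_elim (auto simp: indicator_def)
  qed
  also have "\<dots> \<le> ennreal (max 0 C)" by (rule order_trans[OF fin]) (intro ennreal_leI, simp)
  finally have "(LINT t:{0..2*pi}|lebesgue. (norm (f (of_real r * cis t)))\<^sup>2) \<le> max 0 C"
    unfolding set_lebesgue_integral_def by (intro integral_real_bounded) auto
  then show "1 / (2 * pi) * (LINT t:{0..2*pi}|lebesgue. (norm (f (of_real r * cis t)))\<^sup>2)
      \<le> 1 / (2 * pi) * max 0 C"
    by (intro mult_left_mono) auto
qed

lemma cbrt_holomorphic: "(\<lambda>z. (1 - z) powr (1/3)) holomorphic_on ball 0 1"
proof (intro holomorphic_intros)
  fix z :: complex assume "z \<in> ball 0 1"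
  then show "1 - z \<notin> \<real>\<^sub>\<le>\<^sub>0" using complex_Re_le_cmod[of z]
      by (auto simp: complex_nonpos_Reals_iff)
qed

lemma cbrt_hardy2: "(\<lambda>z. (1 - z) powr (1/3)) \<in> hardy2"
proof (rule hardy2I[where K = "\<lambda>_. ennreal 4" and C = "4 * (2 * pi)"])
  show "(\<integral>\<^sup>+t\<in>{0..2*pi}. ennreal 4 \<partial>lebesgue) \<le> ennreal (4 * (2 * pi))"
    by (subst nn_integral_cmult_indicator) (auto simp: ennreal_mult)
  fix r :: real assume r: "0 \<le> r" "r < 1"
  show "AE t in lebesgue. t \<in> {0..2*pi} \<longrightarrow>
      ennreal ((norm ((1 - of_real r * cis t) powr (1/3)))\<^sup>2) \<le> ennreal 4"
  proof (intro AE_I2 impI ennreal_leI)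
    fix t
    have "norm (1 - of_real r * cis t) \<le> 2"
      by (rule order_trans[OF norm_triangle_ineq4]) (use r in \<open>simp add: norm_mult\<close>)
    then have "norm (1 - of_real r * cis t) powr (1/3) \<le> 2 powr (1/3)"
      by (intro powr_mono2) auto
    also have "\<dots> \<le> 2 powr 1" by (intro powr_mono) auto
    finally have "(norm (1 - of_real r * cis t) powr (1/3))\<^sup>2 \<le> 2\<^sup>2"
      by (intro power_mono) auto
    then show "(norm ((1 - of_real r * cis t) powr (1/3)))\<^sup>2 \<le> 4" by (simp add: norm_cbrt)
  qed
qed (rule cbrt_holomorphic)

text \<open>
  The hypothesis gives $|F g|^2 \le 16 |1-z|^{-2/3} |1+z|^{-2/3}$. Since $|1-z|$ and $|1+z|$ add up
  to at least 2, one factor is at most 1, so the product is at most the sum of the two factors, and each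
  of them is dominated independently of the radius.
\<close>

lemma weighted_hardy2_cbrtI:
  assumes hol: "F holomorphic_on ball 0 1"
    and le: "\<And>z. norm z < 1
        \<Longrightarrow> norm (F z) \<le> 4 * norm (cayley z) powr (2/3) / norm (1 + z)"
  shows "F \<in> weighted_hardy2 (\<lambda>z. (1 - z) powr (1/3))"
  unfolding weighted_hardy2_def
proof (intro CollectI conjI hol)
  have shift: "(\<integral>\<^sup>+t\<in>{0..2*pi}. ennreal (sin_half_powr (t
      + pi)) \<partial>lebesgue) \<le> ennreal (54 * root 3 (3*pi - pi))"
  proof -
    have "(\<integral>\<^sup>+t\<in>{pi..3*pi}. ennreal (sin_half_powr t) \<partial>lborel) =
      ennreal \<bar>1\<bar> * (\<integral>\<^sup>+t. ennreal (sin_half_powr (pi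
          + 1 * t)) * indicator {pi..3*pi} (pi + 1 * t) \<partial>lborel)"
      by (rule nn_integral_real_affine) auto
    also have "\<dots> = (\<integral>\<^sup>+t\<in>{0..2*pi}. ennreal (sin_half_powr (t
        + pi)) \<partial>lborel)"
      by (auto intro!: nn_integral_cong simp: indicator_def add.commute)
    finally show ?thesis
      using nn_integral_sin_half_powr[of pi "3*pi"] by (simp add: nn_integral_completion)
  qed
  have meas: "(\<lambda>t. ennreal (sin_half_powr (t + c)) * indicator {0..2*pi} t)
      \<in> borel_measurable lebesgue" for c
  proof -
    have "(\<lambda>t. ennreal (sin_half_powr (t + c)) * indicator {0..2*pi} t)
        \<in> borel_measurable lborel" by measurable
    then show ?thesis by (rule measurable_completion)
  qed
  show "(\<lambda>z. F z * (1 - z) powr (1/3)) \<in> hardy2"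
  proof (rule hardy2I)
    show "(\<lambda>z. F z * (1 - z) powr (1/3)) holomorphic_on ball 0 1"
      by (intro holomorphic_on_mult hol cbrt_holomorphic)
    have "(\<integral>\<^sup>+t\<in>{0..2*pi}. (ennreal 16 * (ennreal (sin_half_powr (t + 0))
        + ennreal (sin_half_powr (t + pi)))) \<partial>lebesgue) =
       (\<integral>\<^sup>+t. ennreal 16 * (ennreal (sin_half_powr (t + 0)) * indicator {0..2*pi} t
           + ennreal (sin_half_powr (t + pi)) * indicator {0..2*pi} t) \<partial>lebesgue)"
      by (auto intro!: nn_integral_cong simp: indicator_def)
    also have "\<dots> = ennreal 16 * ((\<integral>\<^sup>+t\<in>{0..2*pi}. ennreal (sin_half_powr (t
        + 0)) \<partial>lebesgue) + (\<integral>\<^sup>+t\<in>{0..2*pi}. ennreal (sin_half_powr (t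
            + pi)) \<partial>lebesgue))"
      by (simp only: nn_integral_cmult[OF borel_measurable_add[OF meas meas]] nn_integral_add[OF meas
          meas])
    also have "\<dots> \<le> ennreal 16 * (ennreal (54 * root 3 (2*pi - 0))
        + ennreal (54 * root 3 (3*pi - pi)))"
      using nn_integral_sin_half_powr[of 0 "2*pi"] by (intro mult_left_mono add_mono shift) auto
    also have "\<dots> = ennreal (16 * (54 * root 3 (2*pi - 0) + 54 * root 3 (3*pi - pi)))"
    proof -
      have E: "ennreal 16 * (ennreal x + ennreal y) = ennreal (16 * (x + y))"
          if "x \<ge> 0" "y \<ge> 0" for x y
        using that by (metis ennreal_mult ennreal_plus add_nonneg_nonneg zero_le_numeral)
      show ?thesis by (rule E) auto
    qed
    finally show "(\<integral>\<^sup>+t\<in>{0..2*pi}. (ennreal 16 * (ennreal (sin_half_powr (t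
        + 0)) + ennreal (sin_half_powr (t + pi)))) \<partial>lebesgue)
       \<le> ennreal (16 * (54 * root 3 (2*pi - 0) + 54 * root 3 (3*pi - pi)))" .
    fix r :: real assume r: "0 \<le> r" "r < 1"
    show "AE t in lebesgue. t \<in> {0..2*pi} \<longrightarrow>
       ennreal ((norm (F (of_real r * cis t) * (1 - of_real r * cis t) powr (1/3)))\<^sup>2) \<le>
         ennreal 16 * (ennreal (sin_half_powr (t + 0)) + ennreal (sin_half_powr (t + pi)))"
      using AE_sin_nonzero
    proof eventually_elim
      case (elim t)
      define z where "z = of_real r * cis t"
      define a b where "a = norm (1 - z)" and "b = norm (1 + z)"
      have z: "norm z < 1" using r by (simp add: z_def norm_mult)
      have sin2: "sin t = 2 * sin (t/2) * cos (t/2)" using sin_double[of "t/2"] by simp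
      have a: "\<bar>sin (t / 2)\<bar> \<le> a" "0 < \<bar>sin (t / 2)\<bar>"
        using norm_one_minus_ge[of r t] r elim sin2 by (auto simp: a_def z_def)
      have "z = - (of_real r * cis (t + pi))" by (simp add: z_def flip: cis_mult)
      then have b: "\<bar>sin ((t + pi) / 2)\<bar> \<le> b"
        using norm_one_minus_ge[of r "t + pi"] r by (simp add: b_def)
      have b': "0 < \<bar>sin ((t + pi) / 2)\<bar>" using elim sin2
          by (auto simp: add_divide_distrib sin_add)
      have pos: "a > 0" "b > 0" using a b b' by linarith+
      have "2 \<le> a + b" using norm_triangle_ineq[of "1 - z" "1 + z"] by (simp add: a_def b_def)
      then have one: "a \<ge> 1 \<or> b \<ge> 1" by linarith
      have sa: "a powr (-2/3) \<le> sin_half_powr t" unfolding sin_half_powr_def using a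
          by (intro powr_mono2') auto
      have sb: "b powr (-2/3) \<le> sin_half_powr (t + pi)" unfolding sin_half_powr_def using b b'
          by (intro powr_mono2') auto
      have "norm (F z * (1 - z) powr (1/3)) \<le> (4 * (b / a) powr (2/3) / b) * a powr (1/3)"
        unfolding norm_mult norm_cbrt a_def[symmetric]
        using le[OF z] by (intro mult_right_mono) (auto simp: cayley_def norm_divide a_def b_def)
      also have "\<dots> = 4 * (a powr (-1/3) * b powr (-1/3))"
      proof -
        have "b powr (2/3) = b powr 1 * b powr (-1/3)" "a powr (1/3) = a powr (2/3) * a powr (-1/3)"
          unfolding powr_add[symmetric] by simp_all
        then show ?thesis using pos by (simp add: powr_divide)
      qed
      finally have "(norm (F z * (1 - z) powr (1/3)))\<^sup>2
          \<le> (4 * (a powr (-1/3) * b powr (-1/3)))\<^sup>2"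
        by (intro power_mono) auto
      also have "\<dots> = 16 * (a powr (-2/3) * b powr (-2/3))"
        using pos by (simp add: power_mult_distrib powr_power)
      also have "\<dots> \<le> 16 * (sin_half_powr t + sin_half_powr (t + pi))"
      proof -
        have "x powr (-2/3) \<le> 1" if "x \<ge> 1" for x :: real
          using powr_mono[of "-2/3" 0 x] that by simp
        moreover have "p * q \<le> p + q"
            if "0 \<le> p" "0 \<le> q" "p \<le> 1 \<or> q \<le> 1" for p q :: real
          using that mult_right_mono[of p 1 q] mult_left_mono[of q 1 p] by auto
        ultimately have "a powr (-2/3) * b powr (-2/3) \<le> a powr (-2/3) + b powr (-2/3)"
          using one by (meson powr_ge_zero)
        then show ?thesis
          by (intro mult_left_mono order_trans[OF _ add_mono[OF sa sb]]) auto
      qed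
      finally have "ennreal ((norm (F z * (1 - z) powr (1/3)))\<^sup>2)
          \<le> ennreal (16 * (sin_half_powr t + sin_half_powr (t + pi)))"
        by (rule ennreal_leI)
      also have "\<dots> = ennreal 16 * (ennreal (sin_half_powr (t + 0))
          + ennreal (sin_half_powr (t + pi)))"
        by (simp add: ennreal_mult ennreal_plus)
      finally show ?case by (simp add: z_def)
    qed
  qed
qed

section \<open>The separating function\<close>

definition atomic_inner :: "complex \<Rightarrow> complex" where
  "atomic_inner z = exp (- cayley z)"

definition lacunary_fun :: "complex \<Rightarrow> complex" where
  "lacunary_fun z = lacunary_sum (cayley z) / (1 + z)"

text \<open>
  On the circle this is $I$ times the conjugate of the separating function.
\<close>

definition lacunary_conj :: "complex \<Rightarrow> complex" where
  "lacunary_conj z = z * (atomic_inner z * lacunary_sum (- cayley z)) / (1 + z)"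

lemma atomic_inner_holomorphic: "atomic_inner holomorphic_on - {1}"
  unfolding atomic_inner_def by (intro holomorphic_intros cayley_holomorphic)

lemma lacunary_sum_cayley_holomorphic:
  "(\<lambda>z. lacunary_sum (cayley z)) holomorphic_on - {1}" "(\<lambda>z. lacunary_sum (- cayley
      z)) holomorphic_on - {1}"
proof -
  have "(lacunary_sum \<circ> cayley) holomorphic_on - {1}"
    by (rule holomorphic_on_compose_gen[OF cayley_holomorphic lacunary_sum_holomorphic]) auto
  then show "(\<lambda>z. lacunary_sum (cayley z)) holomorphic_on - {1}" by (simp add: o_def)
  have "(lacunary_sum \<circ> (\<lambda>z. - cayley z)) holomorphic_on - {1}"
    by (rule holomorphic_on_compose_gen[OF holomorphic_on_minus[OF cayley_holomorphic]
        lacunary_sum_holomorphic]) auto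
  then show "(\<lambda>z. lacunary_sum (- cayley z)) holomorphic_on - {1}" by (simp add: o_def)
qed

lemma lacunary_fun_holomorphic: "lacunary_fun holomorphic_on - {1, -1}"
  unfolding lacunary_fun_def
  by (intro holomorphic_intros holomorphic_on_subset[OF lacunary_sum_cayley_holomorphic(1)])
     (auto simp: add_eq_0_iff)

lemma lacunary_conj_holomorphic: "lacunary_conj holomorphic_on - {1, -1}"
  unfolding lacunary_conj_def
  by (intro holomorphic_intros holomorphic_on_subset[OF lacunary_sum_cayley_holomorphic(2)]
        holomorphic_on_subset[OF atomic_inner_holomorphic])
     (auto simp: add_eq_0_iff)

lemma ball_subset_punctured: "ball 0 1 \<subseteq> - {1, -1 :: complex}"
  by auto

lemma AE_cis_punctured: "AE t in lebesgue. cis t \<in> - {1, -1}"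
  using AE_sin_nonzero by eventually_elim (auto simp: complex_eq_iff)

lemma inner_function_atomic: "inner_function atomic_inner"
  unfolding inner_function_def
proof (intro conjI ballI)
  show "atomic_inner holomorphic_on ball 0 1"
    by (rule holomorphic_on_subset[OF atomic_inner_holomorphic]) auto
  show "norm (atomic_inner z) \<le> 1" if "z \<in> ball 0 1" for z
    using Re_cayley_pos[of z] that by (simp add: atomic_inner_def)
  show "AE t in lebesgue. norm (boundary_value atomic_inner (cis t)) = 1"
    using AE_cis_punctured
  proof eventually_elim
    case (elim t)
    then have "boundary_value atomic_inner (cis t) = atomic_inner (cis t)"
      by (intro boundary_value_holomorphic[OF atomic_inner_holomorphic]) auto
    then show ?case by (simp add: atomic_inner_def Re_cayley_cis)
  qed
qed

text \<open>
  The identity on the circle uses that $u$ is imaginary there and that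
  $\overline z (1+z) = 1 + \overline z$.
\<close>

lemma lacunary_fun_in_weighted_model_space:
  "lacunary_fun \<in> weighted_model_space (\<lambda>z. (1 - z) powr (1/3)) atomic_inner"
  unfolding weighted_model_space_def
proof (intro CollectI conjI bexI[of _ lacunary_conj])
  show "lacunary_fun \<in> weighted_hardy2 (\<lambda>z. (1 - z) powr (1/3))"
  proof (rule weighted_hardy2_cbrtI)
    show "lacunary_fun holomorphic_on ball 0 1"
      by (rule holomorphic_on_subset[OF lacunary_fun_holomorphic ball_subset_punctured])
    fix z :: complex assume "norm z < 1"
    then show "norm (lacunary_fun z) \<le> 4 * norm (cayley z) powr (2/3) / norm (1 + z)"
      unfolding lacunary_fun_def norm_divide
      by (intro divide_right_mono norm_lacunary_sum_le less_imp_le[OF Re_cayley_pos]) auto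
  qed
  have "lacunary_conj \<in> weighted_hardy2 (\<lambda>z. (1 - z) powr (1/3))"
  proof (rule weighted_hardy2_cbrtI)
    show "lacunary_conj holomorphic_on ball 0 1"
      by (rule holomorphic_on_subset[OF lacunary_conj_holomorphic ball_subset_punctured])
    fix z :: complex assume z: "norm z < 1"
    have "norm (exp (- cayley z) * lacunary_sum (- cayley z)) \<le> 4 * norm (cayley z) powr (2/3)"
      by (intro norm_exp_lacunary_sum_le less_imp_le[OF Re_cayley_pos] z)
    then have "norm z * norm (exp (- cayley z) * lacunary_sum (- cayley z))
        \<le> 1 * (4 * norm (cayley z) powr (2/3))"
      using z by (intro mult_mono) auto
    then show "norm (lacunary_conj z) \<le> 4 * norm (cayley z) powr (2/3) / norm (1 + z)"
      unfolding lacunary_conj_def norm_divide atomic_inner_def norm_mult[of z]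
      by (intro divide_right_mono) auto
  qed
  then show "lacunary_conj \<in> weighted_hardy2_0 (\<lambda>z. (1 - z) powr (1/3))"
    by (simp add: weighted_hardy2_0_def lacunary_conj_def)
  show "AE t in lebesgue. boundary_value lacunary_fun (cis t) =
      boundary_value atomic_inner (cis t) * cnj (boundary_value lacunary_conj (cis t))"
    using AE_cis_punctured
  proof eventually_elim
    case (elim t)
    define u where "u = cayley (cis t)"
    have cu: "cnj u = - u" using Re_cayley_cis[of t] by (simp add: u_def complex_eq_iff)
    have bv: "boundary_value lacunary_fun (cis t) = lacunary_fun (cis t)"
      "boundary_value atomic_inner (cis t) = atomic_inner (cis t)"
      "boundary_value lacunary_conj (cis t) = lacunary_conj (cis t)"
      using elim by (auto intro!: boundary_value_holomorphic[OF lacunary_fun_holomorphic]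
          boundary_value_holomorphic[OF atomic_inner_holomorphic]
          boundary_value_holomorphic[OF lacunary_conj_holomorphic])
    have ne: "1 + cis t \<noteq> 0" "1 + cis (- t) \<noteq> 0"
      using elim by (auto simp: complex_eq_iff)
    have "cnj (lacunary_conj (cis t)) = cis (- t) * (exp u * lacunary_sum u) / (1 + cis (- t))"
      by (simp add: lacunary_conj_def atomic_inner_def cnj_lacunary_sum exp_cnj cis_cnj cu flip: u_def)
    also have "\<dots> = exp u * lacunary_sum u / (1 + cis t)"
    proof -
      have "cis (- t) * (1 + cis t) = 1 + cis (- t)" by (simp add: distrib_left cis_mult)
      then have "cis (- t) / (1 + cis (- t)) = 1 / (1 + cis t)" using ne by (simp add: frac_eq_eq)
      then show ?thesis by (metis (no_types) mult.commute mult.left_neutral times_divide_eq_left)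
    qed
    finally have "atomic_inner (cis t) * cnj (lacunary_conj (cis t))
        = (exp (- u) * exp u) * lacunary_sum u / (1 + cis t)"
      by (simp add: atomic_inner_def u_def)
    also have "\<dots> = lacunary_fun (cis t)" by (simp add: lacunary_fun_def u_def flip: exp_add)
    finally show ?case by (simp add: bv)
  qed
qed

text \<open>
  On this arc $|1-z| \le 2\delta$, and the real part of $u$ is the Poisson kernel
  $(1-|z|^2)/|1-z|^2$, hence at least $1/(4\delta)$: the exponential in the $n$-th summand of $G(u)$
  is at most $e^{-1/4}$ in modulus.
\<close>

lemma norm_lacunary_fun_ge:
  fixes n :: nat
  defines "\<delta> \<equiv> 1 / 4096 ^ n"
  assumes t: "0 \<le> t" "t \<le> \<delta>"
  shows "norm (lacunary_fun (of_real (1 - \<delta>) * cis t)) \<ge> 128 ^ n * ((1 - exp (- (1/4))) / 2)"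
proof -
  define r z where "r = 1 - \<delta>" and "z = of_real r * cis t"
  have \<delta>: "0 < \<delta>" "\<delta> \<le> 1" by (auto simp: \<delta>_def divide_le_eq one_le_power)
  have r: "0 \<le> r" "r < 1" using \<delta> by (auto simp: r_def)
  have nz: "norm z = r" using r by (simp add: z_def norm_mult)
  have near: "norm (1 - z) \<le> 2 * \<delta>"
  proof -
    have "norm (1 - z) \<le> norm (1 - cis t) + norm (of_real \<delta> * cis t)"
      by (rule order_trans[OF _ norm_triangle_ineq]) (simp add: z_def r_def algebra_simps)
    also have "norm (1 - cis t) \<le> t"
      using abs_sin_x_le_abs_x[of "t/2"] t by (simp add: norm_one_minus_cis)
    also have "norm (of_real \<delta> * cis t) = \<delta>" using \<delta> by (simp add: norm_mult)
    finally show ?thesis using t by simp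
  qed
  have "1 / (4 * \<delta>) = \<delta> / (2 * \<delta>)\<^sup>2" using \<delta>
      by (simp add: power2_eq_square)
  also have "\<dots> \<le> (1 - r\<^sup>2) / (norm (1 - z))\<^sup>2"
  proof (intro frac_le power_mono near)
    show "\<delta> \<le> 1 - r\<^sup>2" using \<delta> mult_left_le[of \<delta> \<delta>]
        by (simp add: r_def power2_eq_square algebra_simps)
    have "1 \<noteq> z" using nz r by auto
    then show "0 < (norm (1 - z))\<^sup>2" by simp
  qed (use r in \<open>auto simp: power_le_one\<close>)
  finally have Re: "1 / (4 * \<delta>) \<le> Re (cayley z)" by (simp add: Re_cayley nz)
  then have "1/4 \<le> Re (cayley z) / 4096 ^ n" using \<delta> by (simp add: \<delta>_def field_simps)
  then have "128 ^ n * (1 - exp (- (1/4))) \<le> 128 ^ n * (1 - exp (- (Re (cayley z) / 4096 ^ n)))"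
    by (intro mult_left_mono) auto
  also have "\<dots> \<le> Re (lacunary_sum (cayley z))"
    by (intro Re_lacunary_sum_ge less_imp_le[OF Re_cayley_pos]) (use nz r in simp)
  also have "\<dots> \<le> norm (lacunary_sum (cayley z))" by (rule complex_Re_le_cmod)
  finally have "128 ^ n * (1 - exp (- (1/4))) / 2 \<le> norm (lacunary_sum (cayley z)) / 2" by simp
  also have "\<dots> \<le> norm (lacunary_sum (cayley z)) / norm (1 + z)"
  proof (intro divide_left_mono)
    show "norm (1 + z) \<le> 2" by (rule order_trans[OF norm_triangle_ineq]) (use nz r in simp)
    have "1 + z \<noteq> 0" using nz r by (auto simp: add_eq_0_iff)
    then show "0 < 2 * norm (1 + z)" by simp
  qed auto
  finally show ?thesis by (simp add: lacunary_fun_def norm_divide z_def r_def)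
qed

lemma lacunary_fun_notin_hardy2: "lacunary_fun \<notin> hardy2"
proof
  assume "lacunary_fun \<in> hardy2"
  then obtain B where B: "\<And>r. r \<in> {0..<1} \<Longrightarrow>
      1 / (2 * pi) * (LINT t:{0..2*pi}|lebesgue. (norm (lacunary_fun (of_real r * cis t)))\<^sup>2)
          \<le> B"
    unfolding hardy2_def bdd_above_def by blast
  define \<kappa> where "\<kappa> = (1 - exp (- (1/4::real))) / 2"
  have \<kappa>: "\<kappa> > 0" by (simp add: \<kappa>_def)
  \<comment> \<open>The arc has length $4096^{-n}$ and the square of the lower bound is $128^{2n}$ up
      to a constant.\<close>
  have low: "4 ^ n * \<kappa>\<^sup>2 \<le> 2 * pi * B" for n
  proof -
    define \<delta> :: real where "\<delta> = 1 / 4096 ^ n"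
    define r where "r = 1 - \<delta>"
    have \<delta>: "0 < \<delta>" "\<delta> \<le> 1"
        by (auto simp: \<delta>_def divide_le_eq one_le_power)
    have r: "r \<in> {0..<1}" using \<delta> by (auto simp: r_def)
    define h where "h t = (norm (lacunary_fun (of_real r * cis t)))\<^sup>2" for t
    have "continuous_on {0..2*pi} h"
      unfolding h_def
    proof (intro continuous_intros continuous_on_compose2[OF holomorphic_on_imp_continuous_on[OF
        lacunary_fun_holomorphic]])
      show "(\<lambda>t. of_real r * cis t) ` {0..2*pi} \<subseteq> - {1, -1}"
      proof
        fix w assume "w \<in> (\<lambda>t. of_real r * cis t) ` {0..2*pi}"
        then have "norm w < 1" using r by (auto simp: norm_mult)
        then show "w \<in> - {1, -1}" by auto
      qed
    qed
    then have int: "set_integrable lebesgue {0..2*pi} h"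
      using absolutely_integrable_continuous[of 0 "2*pi" h] by simp
    have "4 ^ n * \<kappa>\<^sup>2 = \<delta> * (128 ^ n * \<kappa>)\<^sup>2"
    proof -
      have "(128 ^ n)\<^sup>2 = 4 ^ n * (4096::real) ^ n"
          by (simp add: power2_eq_square flip: power_mult_distrib)
      then show ?thesis by (simp add: \<delta>_def power_mult_distrib)
    qed
    also have "\<dots> = (LINT t:{0..\<delta>}|lebesgue. (128 ^ n * \<kappa>)\<^sup>2)"
      using \<delta> by (simp add: set_lebesgue_integral_def)
    also have "\<dots> \<le> (LINT t:{0..2*pi}|lebesgue. h t)"
      unfolding set_lebesgue_integral_def
    proof (rule integral_mono)
      show "integrable lebesgue (\<lambda>t. indicator {0..2*pi} t *\<^sub>R h t)"
        using int by (simp add: set_integrable_def)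
      show "integrable lebesgue (\<lambda>t. indicator {0..\<delta>} t *\<^sub>R (128 ^ n *
          \<kappa>)\<^sup>2)"
        using \<delta> by (intro integrable_scaleR_left integrable_real_indicator) auto
      fix t
      have "(128 ^ n * \<kappa>)\<^sup>2 \<le> h t" if "t \<in> {0..\<delta>}"
        unfolding h_def \<kappa>_def r_def using norm_lacunary_fun_ge[of t n] that
        by (intro power_mono) (auto simp: \<delta>_def)
      moreover have "\<delta> \<le> 2 * pi" using \<delta> pi_gt3 by linarith
      moreover have "h t \<ge> 0" by (simp add: h_def)
      ultimately show "indicator {0..\<delta>} t *\<^sub>R (128 ^ n * \<kappa>)\<^sup>2
          \<le> indicator {0..2*pi} t *\<^sub>R h t"
        by (auto simp: indicator_def)
    qed
    also have "\<dots> \<le> 2 * pi * B" using B[OF r] by (simp add: h_def field_simps)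
    finally show ?thesis .
  qed
  obtain n where "2 * pi * B / \<kappa>\<^sup>2 < 4 ^ n" using real_arch_pow[of 4] by auto
  then show False using low[of n] \<kappa> by (simp add: field_simps)
qed

theorem proposition4:
  shows "\<exists>g I. outer_function g \<and> g \<in> hardy2 \<and>
    muckenhoupt_A2 (\<lambda>z. (norm (boundary_value g z))\<^sup>2) \<and>
    inner_function I \<and>
    \<not> weighted_model_space g I \<subseteq> model_space I"
proof (intro exI conjI)
  let ?g = "\<lambda>z::complex. (1 - z) powr (1/3)"
  show "outer_function ?g" by (rule outer_cbrt)
  show "?g \<in> hardy2" by (rule cbrt_hardy2)
  have "(norm (boundary_value ?g (cis t)))\<^sup>2 = norm (1 - cis t) powr (2/3)" for t
    by (simp add: norm_boundary_value_cbrt power2_eq_square flip: powr_add)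
  then show "muckenhoupt_A2 (\<lambda>z. (norm (boundary_value ?g z))\<^sup>2)"
    using muckenhoupt_cbrt unfolding muckenhoupt_A2_def by simp
  show "inner_function atomic_inner" by (rule inner_function_atomic)
  have "lacunary_fun \<notin> model_space atomic_inner"
    using lacunary_fun_notin_hardy2 by (simp add: model_space_def)
  then show "\<not> weighted_model_space ?g atomic_inner \<subseteq> model_space atomic_inner"
    using lacunary_fun_in_weighted_model_space by blast
qed

end
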